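(* \textsc{Set Cover} is polynomial-time reducible to \textsc{u-bcmd}. Moreover, the reduction is parameter preserving (an instance $(X,S,k)$ of \textsc{Set Cover} is mapped to an instance $(G,k,d)$ of \textsc{u-bcmd} with the same $k$) and creates an instance in which $G$ has diameter $3$ and the target diameter is $d=2$.
   Context: \textsc{Set Cover}: given a finite base set $S$, a family $X\subseteq\mathcal{P}(S)$ and an integer $k$, decide whether there exist at most $k$ members of $X$ whose union is $S$; the parameter is $k$. \textsc{u-bcmd}: given an unweighted undirected graph $G=(V,E)$ and integers $k$ and $d$, decide whether there is a set $F\subseteq[V]^2\setminus E$ (where $[V]^2$ is the set of unordered vertex pairs) with $|F|\le k$ such that the graph $(V,E\cup F)$ has diameter at most $d$; the parameter is $k$.
   Formalization: Diameter 3 is not claimed when S is empty and k = 0 (a yes-instance, while a diameter-3 graph with k = 0, d = 2 is a no-instance); k is written in unary, since with k in binary no reduction keeping the same k exists (immaterial for k ≤ |X|). *)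

theory Defs
  imports
    Complex_Main
    "HOL-Library.Extended_Nat"
    "HOL-Library.Ramsey"
    "HOL-Computational_Algebra.Polynomial"
begin

section \<open>Deterministic multi-tape Turing machines\<close>

text \<open>
  A machine with \<open>Q\<close> states has working states \<open>0, \<dots>, Q - 1\<close>, initial state \<open>0\<close> and halting
  state \<open>Q\<close>. The tape alphabet is \<open>0, \<dots>, G - 1\<close>, where \<open>0\<close> is the blank and \<open>1\<close>, \<open>2\<close> represent
  the bits \<open>False\<close>, \<open>True\<close>. Tapes are infinite in both directions. Only the values of
  \<open>delta\<close> at working states and at lists of \<open>tapes\<close> many tape symbols matter, so a machine is
  a finite table.
\<close>

datatype move = Left | Stay | Right

fun shift :: "move \<Rightarrow> int" where
  "shift Left = -1"
| "shift Stay = 0"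
| "shift Right = 1"

record machine =
  tapes :: nat
  states :: nat
  symbols :: nat
  delta :: "nat \<Rightarrow> nat list \<Rightarrow> nat \<times> (nat \<times> move) list"

definition turing_machine :: "machine \<Rightarrow> bool" where
  "turing_machine M \<longleftrightarrow>
     tapes M \<ge> 2 \<and> symbols M \<ge> 3 \<and>
     (\<forall>q < states M. \<forall>ss. length ss = tapes M \<and> set ss \<subseteq> {..<symbols M} \<longrightarrow>
        (case delta M q ss of (q', acts) \<Rightarrow>
           q' \<le> states M \<and> length acts = tapes M \<and> (\<forall>(s, d) \<in> set acts. s < symbols M)))"

text \<open>A tape is given by its contents and the position of its head.\<close>

type_synonym tape = "(int \<Rightarrow> nat) \<times> int"
type_synonym config = "nat \<times> tape list"

definition step :: "machine \<Rightarrow> config \<Rightarrow> config" where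
  "step M = (\<lambda>(q, ts).
     if q < states M
     then (case delta M q (map (\<lambda>(c, h). c h) ts) of (q', acts) \<Rightarrow>
             (q', map2 (\<lambda>(c, h) (s, d). (c(h := s), h + shift d)) ts acts))
     else (q, ts))"

definition word_tape :: "bool list \<Rightarrow> int \<Rightarrow> nat" where
  "word_tape w i =
     (if 0 \<le> i \<and> i < int (length w) then (if w ! nat i then 2 else 1) else 0)"

definition init :: "machine \<Rightarrow> bool list \<Rightarrow> config" where
  "init M w = (0, (word_tape w, 0) # replicate (tapes M - 1) (word_tape [], 0))"

text \<open>
  The input is on tape 0 and the output on tape 1. A halted configuration no longer changes,
  so \<open>t\<close> is an upper bound for the running time.
\<close>

definition outputs_within :: "machine \<Rightarrow> bool list \<Rightarrow> nat \<Rightarrow> bool list \<Rightarrow> bool" where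
  "outputs_within M w t v \<longleftrightarrow>
     (case (step M ^^ t) (init M w) of (q, ts) \<Rightarrow> q = states M \<and> fst (ts ! 1) = word_tape v)"

definition poly_time_computable_on :: "bool list set \<Rightarrow> (bool list \<Rightarrow> bool list) \<Rightarrow> bool" where
  "poly_time_computable_on D f \<longleftrightarrow>
     (\<exists>M. \<exists>p :: nat poly. turing_machine M \<and>
        (\<forall>w\<in>D. outputs_within M w (poly p (length w)) (f w)))"


section \<open>Set Cover\<close>

definition set_cover_instance :: "'a set \<Rightarrow> 'a set set \<Rightarrow> bool" where
  "set_cover_instance S X \<longleftrightarrow> finite S \<and> X \<subseteq> Pow S"

definition set_cover :: "'a set \<Rightarrow> 'a set set \<Rightarrow> nat \<Rightarrow> bool" where
  "set_cover S X k \<longleftrightarrow> (\<exists>C \<subseteq> X. card C \<le> k \<and> \<Union>C = S)"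

text \<open>
  The pair \<open>S = {}\<close>, \<open>k = 0\<close> is a yes-instance (empty union). Since a graph of diameter \<open>3\<close> is a
  no-instance of the augmentation problem below for \<open>k = 0\<close> and \<open>d = 2\<close>, no reduction can produce
  diameter \<open>3\<close> there.
\<close>


section \<open>Unweighted bounded cardinality minimum diameter\<close>

definition ugraph :: "'a set \<Rightarrow> 'a set set \<Rightarrow> bool" where
  "ugraph V E \<longleftrightarrow> finite V \<and> E \<subseteq> [V]\<^bsup>2\<^esup>"

text \<open>The relational power contains the pairs of vertices that are joined by a walk of length \<open>n\<close>;
  the distance is \<open>\<infinity>\<close> if there is no walk.\<close>

definition graph_dist :: "'a set set \<Rightarrow> 'a \<Rightarrow> 'a \<Rightarrow> enat" where
  "graph_dist E u v = (INF n \<in> {n. (u, v) \<in> {(x, y). {x, y} \<in> E} ^^ n}. enat n)"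

definition graph_diameter :: "'a set \<Rightarrow> 'a set set \<Rightarrow> enat" where
  "graph_diameter V E = (SUP u \<in> V. SUP v \<in> V. graph_dist E u v)"

definition u_bcmd :: "'a set \<Rightarrow> 'a set set \<Rightarrow> nat \<Rightarrow> nat \<Rightarrow> bool" where
  "u_bcmd V E k d \<longleftrightarrow>
     (\<exists>F \<subseteq> [V]\<^bsup>2\<^esup> - E. card F \<le> k \<and> graph_diameter V (E \<union> F) \<le> enat d)"


section \<open>Instances as binary words\<close>

text \<open>
  An instance is written down with respect to an enumeration of the base set and of the family
  (resp. of the vertices) as an incidence matrix (resp. adjacency matrix), row by row, preceded by
  the dimensions and the integer parameters, which are in unary. For instances of Set Cover with
  \<open>k \<le> card X\<close> the unary encoding of \<open>k\<close> changes the length of the word only polynomially.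
  With \<open>k\<close> in binary no parameter preserving reduction with target diameter \<open>2\<close>
  can exist: if \<open>X\<close> does not cover \<open>S\<close>,
  then \<open>(S, X, k)\<close> is a no-instance for every \<open>k\<close>, whereas a graph of size polynomial in \<open>log k\<close>
  can be completed by adding at most \<open>k\<close> edges once \<open>k\<close> is large.
\<close>

definition unary :: "nat \<Rightarrow> bool list" where
  "unary n = replicate n True @ [False]"

definition set_cover_code :: "bool list \<Rightarrow> 'a set \<Rightarrow> 'a set set \<Rightarrow> nat \<Rightarrow> bool" where
  "set_cover_code w S X k \<longleftrightarrow> set_cover_instance S X \<and>
     (\<exists>xs Ys. distinct xs \<and> set xs = S \<and> distinct Ys \<and> set Ys = X \<and>
        w = unary (length xs) @ unary (length Ys) @ unary k @
            concat (map (\<lambda>Y. map (\<lambda>x. x \<in> Y) xs) Ys))"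

definition u_bcmd_code :: "bool list \<Rightarrow> 'a set \<Rightarrow> 'a set set \<Rightarrow> nat \<Rightarrow> nat \<Rightarrow> bool" where
  "u_bcmd_code w V E k d \<longleftrightarrow> ugraph V E \<and>
     (\<exists>vs. distinct vs \<and> set vs = V \<and>
        w = unary (length vs) @ unary k @ unary d @
            concat (map (\<lambda>u. map (\<lambda>v. {u, v} \<in> E) vs) vs))"

end

theory Submission
  imports Defs "HOL-Library.Countable"
begin

text \<open>
  Attach to the sets, which form a clique, a pendant path whose end is a root, and represent every
  element by a grid of \<open>q \<times> (q + 1)\<close> points with \<open>q = 2 * k + 1\<close>. Two points, of the same or of
  different elements, are adjacent iff they lie in the same row or in the same column, so any two of
  them are at distance at most \<open>2\<close>. Only the pairs of the root and a point outside the last column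
  are at distance \<open>3\<close>. An edge from the root to a set repairs all pairs for the elements of the set.
  Conversely, \<open>k\<close> new edges miss some row and some column, and the points there can only be reached
  through new edges from the root to sets.

  The adjacency matrix of this graph is printed by nested loops whose bodies evaluate arithmetic
  expressions. Such programs run on counters, which are realised by head positions, and polynomial
  time follows from a polynomial bound for the values of the expressions.
\<close>


section \<open>Counter programs\<close>

datatype instr = Inc nat | Dec nat | Sample nat | Emit nat | Forward | Backward

datatype test = Nonzero nat | Bit

datatype prog = Instr instr | Seq prog prog (infixr \<open>;;\<close> 60) | While test prog

type_synonym store = "(nat \<Rightarrow> nat) \<times> int \<times> bool list"

fun effect :: "bool list \<Rightarrow> instr \<Rightarrow> store \<Rightarrow> store" where
  "effect w (Inc x) (c, h, out) = (c(x := Suc (c x)), h, out)"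
| "effect w (Dec x) (c, h, out) = (c(x := c x - 1), h, out)"
| "effect w (Sample x) (c, h, out) = (c(x := c x + of_bool (word_tape w h = 2)), h, out)"
| "effect w (Emit x) (c, h, out) = (c, h, out @ [c x \<noteq> 0])"
| "effect w Forward (c, h, out) = (c, h + 1, out)"
| "effect w Backward (c, h, out) = (c, h - 1, out)"

text \<open>A blank cell is read like the bit \<open>False\<close>, so the head may leave the input
  word.\<close>

fun holds :: "bool list \<Rightarrow> test \<Rightarrow> store \<Rightarrow> bool" where
  "holds w (Nonzero x) (c, h, out) \<longleftrightarrow> c x \<noteq> 0"
| "holds w Bit (c, h, out) \<longleftrightarrow> word_tape w h = 2"

text \<open>
  Every loop is allowed at most \<open>B\<close> iterations. Hence the running time is bounded by a polynomial
  in \<open>B\<close> that depends on the program text only.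
\<close>

primrec exec :: "bool list \<Rightarrow> nat \<Rightarrow> prog \<Rightarrow> store \<Rightarrow> store \<Rightarrow> bool" where
  "exec w B (Instr i) = (\<lambda>s s'. s' = effect w i s)"
| "exec w B (p ;; q) = exec w B p OO exec w B q"
| "exec w B (While b p) =
     (\<lambda>s s'. \<exists>n\<le>B. ((\<lambda>r r'. holds w b r \<and> exec w B p r r') ^^ n) s s' \<and> \<not> holds w b s')"

text \<open>One step per instruction and per evaluation of a loop test; the last \<open>1\<close> is
  the failing test that leaves the loop.\<close>

primrec cost :: "nat \<Rightarrow> prog \<Rightarrow> nat" where
  "cost B (Instr i) = 1"
| "cost B (p ;; q) = cost B p + cost B q"
| "cost B (While b p) = B * (cost B p + 1) + 1"

lemma cost_poly: "\<exists>q :: nat poly. \<forall>B. cost B p = poly q B"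
proof (induction p)
  case (Instr i)
  have "\<forall>B. cost B (Instr i) = poly [:1:] B" by simp
  then show ?case by blast
next
  case (Seq p1 p2)
  then obtain q1 q2 :: "nat poly" where
    "\<forall>B. cost B p1 = poly q1 B" "\<forall>B. cost B p2 = poly q2 B" by blast
  then have "\<forall>B. cost B (p1 ;; p2) = poly (q1 + q2) B" by simp
  then show ?case by blast
next
  case (While b p)
  then obtain q :: "nat poly" where "\<forall>B. cost B p = poly q B" by blast
  then have "\<forall>B. cost B (While b p) = poly ([:0, 1:] * (q + 1) + 1) B" by simp
  then show ?case by blast
qed


section \<open>Compilation to Turing machines\<close>

text \<open>
  The value of a counter is the position of the head on a tape whose only non-blank cell is a mark
  at position \<open>0\<close>.
\<close>

definition mark :: "int \<Rightarrow> nat" where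
  "mark i = of_bool (i = 0)"

fun tapes_of :: "bool list \<Rightarrow> nat \<Rightarrow> store \<Rightarrow> tape list" where
  "tapes_of w R (c, h, out) =
     (word_tape w, h) # (word_tape out, int (length out)) # map (\<lambda>x. (mark, int (c x))) [0..<R]"

text \<open>Tapes \<open>0\<close> and \<open>1\<close> hold input and output, hence the offset
  \<open>2\<close>. A counter is zero iff its head scans the mark \<open>1\<close>, so a scanned
  \<open>0\<close> means nonzero, and \<open>Dec\<close> stays on the mark as truncated subtraction
  demands.\<close>

fun action :: "instr \<Rightarrow> nat list \<Rightarrow> nat \<Rightarrow> nat \<times> move" where
  "action (Inc x) ss y = (ss ! y, if y = x + 2 then Right else Stay)"
| "action (Dec x) ss y = (ss ! y, if y = x + 2 \<and> ss ! y = 0 then Left else Stay)"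
| "action (Sample x) ss y = (ss ! y, if y = x + 2 \<and> ss ! 0 = 2 then Right else Stay)"
| "action (Emit x) ss y =
     (if y = 1 then (if ss ! (x + 2) = 0 then 2 else 1, Right) else (ss ! y, Stay))"
| "action Forward ss y = (ss ! y, if y = 0 then Right else Stay)"
| "action Backward ss y = (ss ! y, if y = 0 then Left else Stay)"

fun passes :: "test \<Rightarrow> nat list \<Rightarrow> bool" where
  "passes (Nonzero x) ss \<longleftrightarrow> ss ! (x + 2) = 0"
| "passes Bit ss \<longleftrightarrow> ss ! 0 = 2"

text \<open>Number of states; a loop has one extra state in front of its body for the test.\<close>

primrec len :: "prog \<Rightarrow> nat" where
  "len (Instr i) = 1"
| "len (p ;; q) = len p + len q"
| "len (While b p) = Suc (len p)"

text \<open>The code of a program occupies the states from \<open>a\<close> on and leaves to state \<open>e\<close>.\<close>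

primrec code ::
    "prog \<Rightarrow> nat \<Rightarrow> nat \<Rightarrow> nat \<Rightarrow> nat list \<Rightarrow> nat \<times> (nat \<times> move) list" where
  "code (Instr i) a e q ss = (e, map (action i ss) [0..<length ss])"
| "code (p1 ;; p2) a e q ss =
     (if q < a + len p1 then code p1 a (a + len p1) q ss else code p2 (a + len p1) e q ss)"
| "code (While b p) a e q ss =
     (if q = a then (if passes b ss then Suc a else e, map (\<lambda>s. (s, Stay)) ss)
      else code p (Suc a) a q ss)"

fun instr_width :: "instr \<Rightarrow> nat" where
  "instr_width (Inc x) = Suc x"
| "instr_width (Dec x) = Suc x"
| "instr_width (Sample x) = Suc x"
| "instr_width (Emit x) = Suc x"
| "instr_width Forward = 0"
| "instr_width Backward = 0"

fun test_width :: "test \<Rightarrow> nat" where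
  "test_width (Nonzero x) = Suc x"
| "test_width Bit = 0"

primrec width :: "prog \<Rightarrow> nat" where
  "width (Instr i) = instr_width i"
| "width (p ;; q) = max (width p) (width q)"
| "width (While b p) = max (test_width b) (width p)"

text \<open>The condition of \<open>turing_machine\<close> on the table, for a block of states
  inside a larger machine. The exit \<open>e\<close> may lie before the block, as it does for the
  body of a loop.\<close>

lemma code_valid:
  assumes "a \<le> q" "q < a + len p" "a + len p \<le> N" "e \<le> N"
    and "width p + 2 \<le> length ss" "set ss \<subseteq> {..<3}"
  shows "fst (code p a e q ss) \<le> N \<and> length (snd (code p a e q ss)) = length ss \<and>
    (\<forall>(s, d) \<in> set (snd (code p a e q ss)). s < 3)"
  using assms
proof (induction p arbitrary: a e)
  case (Instr i)
  then have *: "ss ! y < 3" if "y < length ss" for y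
    using that by (auto simp: subset_iff)
  then show ?case
    using Instr by (cases i) auto
next
  case (Seq p1 p2)
  then show ?case
    using Seq.IH(1)[of a "a + len p1"] Seq.IH(2)[of "a + len p1" e] by (cases "q < a + len p1") auto
next
  case (While b p)
  then show ?case
    using While.IH[of "Suc a" a] by (cases "q = a") auto
qed

lemma word_tape_length: "word_tape out (int (length out)) = 0"
  by (simp add: word_tape_def)

lemma word_tape_snoc:
  "(word_tape out)(int (length out) := if b then 2 else 1) = word_tape (out @ [b])"
  by (auto simp: word_tape_def fun_eq_iff nth_append nat_less_iff)

section \<open>Single machine steps on encoded stores\<close>

definition scan :: "tape list \<Rightarrow> nat list" where
  "scan ts = map (\<lambda>(c, h). c h) ts"

definition update :: "tape list \<Rightarrow> (nat \<times> move) list \<Rightarrow> tape list" where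
  "update ts acts = map2 (\<lambda>(c, h) (s, d). (c(h := s), h + shift d)) ts acts"

lemma step_eq:
  assumes "q < states M" "delta M q (scan ts) = (q', acts)"
  shows "step M (q, ts) = (q', update ts acts)"
  using assms by (simp add: step_def scan_def update_def)

lemma length_tapes_of: "length (tapes_of w R s) = R + 2"
  by (cases s) simp

lemma nth_tapes_of:
  "y < R + 2 \<Longrightarrow> tapes_of w R (c, h, out) ! y =
    (if y = 0 then (word_tape w, h) else if y = 1 then (word_tape out, int (length out))
     else (mark, int (c (y - 2))))"
  by (auto simp: nth_Cons split: nat.splits)

text \<open>The output head stands on the blank just behind the output, and a counter head sees the
  mark iff the counter is \<open>0\<close>.\<close>

lemma nth_scan_tapes_of:
  "y < R + 2 \<Longrightarrow> scan (tapes_of w R (c, h, out)) ! y =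
    (if y = 0 then word_tape w h else if y = 1 then 0 else of_bool (c (y - 2) = 0))"
  by (simp add: scan_def length_tapes_of nth_tapes_of word_tape_length mark_def del: tapes_of.simps)

lemma length_scan: "length (scan ts) = length ts"
  by (simp add: scan_def)

lemma update_stay: "update ts (map (\<lambda>s. (s, Stay)) (scan ts)) = ts"
  by (rule nth_equalityI) (auto simp: update_def scan_def split: prod.splits)

lemma passes_iff:
  "test_width b \<le> R \<Longrightarrow> passes b (scan (tapes_of w R s)) \<longleftrightarrow> holds w b s"
  by (cases s; cases b) (simp_all add: nth_scan_tapes_of del: tapes_of.simps)

lemma update_action:
  assumes "instr_width i \<le> R"
  shows "update (tapes_of w R s) (map (action i (scan (tapes_of w R s))) [0..<R + 2]) =
    tapes_of w R (effect w i s)"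
proof (rule nth_equalityI)
  obtain c h out where s: "s = (c, h, out)" by (cases s)
  show "length (update (tapes_of w R s) (map (action i (scan (tapes_of w R s))) [0..<R + 2])) =
    length (tapes_of w R (effect w i s))"
    by (simp add: update_def length_tapes_of)
  fix y
  assume "y < length (update (tapes_of w R s) (map (action i (scan (tapes_of w R s))) [0..<R + 2]))"
  then have y: "y < R + 2" by (simp add: update_def length_tapes_of)
  have "update (tapes_of w R s) (map (action i (scan (tapes_of w R s))) [0..<R + 2]) ! y =
    (case tapes_of w R s ! y of (c, h) \<Rightarrow> case action i (scan (tapes_of w R s)) y of (s, d) \<Rightarrow>
       (c(h := s), h + shift d))"
    using y by (simp add: update_def length_tapes_of del: upt_Suc split: prod.splits)
  also have "\<dots> = tapes_of w R (effect w i s) ! y"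
    using y assms
    by (cases i) (auto simp: s nth_tapes_of nth_scan_tapes_of word_tape_snoc[symmetric]
        word_tape_length mark_def fun_eq_iff simp del: tapes_of.simps)
  finally show "update (tapes_of w R s) (map (action i (scan (tapes_of w R s))) [0..<R + 2]) ! y =
    tapes_of w R (effect w i s) ! y" .
qed

text \<open>Only the transitions in the states of the block are prescribed, so the induction
  hypothesis applies to subprograms inside the same machine. The time is an exact step count, which
  can be added up; the cost is an upper bound.\<close>

lemma simulation:
  assumes "\<And>q ss. a \<le> q \<Longrightarrow> q < a + len p \<Longrightarrow> delta M q ss = code p a e q ss"
    and "a + len p \<le> states M" "width p \<le> R" "exec w B p s s'"
  shows "\<exists>t\<le>cost B p. (step M ^^ t) (a, tapes_of w R s) = (e, tapes_of w R s')"
  using assms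
proof (induction p arbitrary: a e s s')
  case (Instr i)
  then have "step M (a, tapes_of w R s) = (e, tapes_of w R s')"
    using update_action[of i R w s] by (simp add: step_eq length_scan length_tapes_of del: upt_Suc)
  then have "(step M ^^ 1) (a, tapes_of w R s) = (e, tapes_of w R s')" by simp
  then show ?case by force
next
  case (Seq p1 p2)
  then obtain s1 where s1: "exec w B p1 s s1" "exec w B p2 s1 s'" by auto
  obtain t1 where t1: "t1 \<le> cost B p1"
      "(step M ^^ t1) (a, tapes_of w R s) = (a + len p1, tapes_of w R s1)"
    using Seq.IH(1)[of a "a + len p1" s s1] Seq.prems s1 by force
  obtain t2 where t2: "t2 \<le> cost B p2"
      "(step M ^^ t2) (a + len p1, tapes_of w R s1) = (e, tapes_of w R s')"
    using Seq.IH(2)[of "a + len p1" e s1 s'] Seq.prems s1 by force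
  have "(step M ^^ (t2 + t1)) (a, tapes_of w R s) = (e, tapes_of w R s')"
    by (simp add: funpow_add t1 t2)
  moreover have "t2 + t1 \<le> cost B (p1 ;; p2)" using t1 t2 by simp
  ultimately show ?case by blast
next
  case (While b p)
  have test: "step M (a, tapes_of w R r) = (if holds w b r then Suc a else e, tapes_of w R r)" for r
    using While.prems by (simp add: step_eq passes_iff update_stay)
  \<comment> \<open>Each round is one step for the test and a run of the body, which exits to the
    test state \<open>a\<close>.\<close>
  have loop: "\<exists>t\<le>n * (cost B p + 1). (step M ^^ t) (a, tapes_of w R s) = (a, tapes_of w R r)"
    if "((\<lambda>r r'. holds w b r \<and> exec w B p r r') ^^ n) s r" for n r
    using that
  proof (induction n arbitrary: r)
    case 0
    then show ?case by simp
  next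
    case (Suc n)
    then obtain u where u: "((\<lambda>r r'. holds w b r \<and> exec w B p r r') ^^ n) s u"
        "holds w b u" "exec w B p u r"
      by auto
    obtain t1 where t1: "t1 \<le> n * (cost B p + 1)"
        "(step M ^^ t1) (a, tapes_of w R s) = (a, tapes_of w R u)"
      using Suc.IH[OF u(1)] by blast
    obtain t2 where t2: "t2 \<le> cost B p"
        "(step M ^^ t2) (Suc a, tapes_of w R u) = (a, tapes_of w R r)"
      using While.IH[of "Suc a" a u r] While.prems u by force
    have "(step M ^^ (t2 + (1 + t1))) (a, tapes_of w R s) = (a, tapes_of w R r)"
      by (simp only: funpow_add o_apply t1) (simp add: t2 test u)
    moreover have "t2 + (1 + t1) \<le> Suc n * (cost B p + 1)" using t1 t2 by simp
    ultimately show ?case by blast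
  qed
  obtain n where n: "n \<le> B" "((\<lambda>r r'. holds w b r \<and> exec w B p r r') ^^ n) s s'"
      "\<not> holds w b s'"
    using While.prems by auto
  obtain t where t: "t \<le> n * (cost B p + 1)"
      "(step M ^^ t) (a, tapes_of w R s) = (a, tapes_of w R s')"
    using loop[OF n(2)] by blast
  have "(step M ^^ (1 + t)) (a, tapes_of w R s) = (e, tapes_of w R s')"
    by (simp add: t test n)
  moreover have "n * (cost B p + 1) \<le> B * (cost B p + 1)"
    using n by (intro mult_right_mono) auto
  then have "1 + t \<le> cost B (While b p)" using t by simp
  ultimately show ?case by blast
qed

text \<open>State \<open>0\<close> writes the mark on the blank counter tapes; the code starts at
  state \<open>1\<close>, and its exit \<open>Suc (len p)\<close> is the halting state.\<close>

definition machine_of :: "prog \<Rightarrow> machine" where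
  "machine_of p = \<lparr>tapes = width p + 2, states = Suc (len p), symbols = 3,
     delta = (\<lambda>q ss. if q = 0
       then (1, map (\<lambda>y. (if y < 2 then ss ! y else 1, Stay)) [0..<length ss])
       else code p 1 (Suc (len p)) q ss)\<rparr>"

lemma turing_machine_machine_of: "turing_machine (machine_of p)"
  unfolding turing_machine_def
proof (intro conjI allI impI)
  fix q ss
  assume q: "q < states (machine_of p)"
    and ss: "length ss = tapes (machine_of p) \<and> set ss \<subseteq> {..<symbols (machine_of p)}"
  have *: "ss ! y < 3" if "y < length ss" for y
    using ss that by (auto simp: subset_iff machine_of_def)
  have "q \<noteq> 0 \<Longrightarrow> fst (code p 1 (Suc (len p)) q ss) \<le> Suc (len p) \<and>
    length (snd (code p 1 (Suc (len p)) q ss)) = length ss \<and>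
    (\<forall>(s, d) \<in> set (snd (code p 1 (Suc (len p)) q ss)). s < 3)"
    by (rule code_valid) (use q ss in \<open>auto simp: machine_of_def\<close>)
  with * ss show "case delta (machine_of p) q ss of (q', acts) \<Rightarrow> q' \<le> states (machine_of p) \<and>
      length acts = tapes (machine_of p) \<and> (\<forall>(s, d) \<in> set acts. s < symbols (machine_of p))"
    by (cases "q = 0") (auto simp: machine_of_def split: prod.splits)
qed (simp_all add: machine_of_def)

lemma step_init:
  "step (machine_of p) (init (machine_of p) w) = (1, tapes_of w (width p) (\<lambda>_. 0, 0, []))"
proof -
  define ts where "ts = (word_tape w, 0::int) # replicate (width p + 1) (word_tape [], 0)"
  define acts where
    "acts = map (\<lambda>y. (if y < 2 then scan ts ! y else 1, Stay)) [0..<width p + 2]"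
  have "step (machine_of p) (0, ts) = (1, update ts acts)"
    by (rule step_eq) (simp_all add: machine_of_def acts_def length_scan ts_def del: upt_Suc)
  moreover have "update ts acts = tapes_of w (width p) (\<lambda>_. 0, 0, [])"
  proof (rule nth_equalityI)
    fix y
    assume "y < length (update ts acts)"
    then have "y < width p + 2" by (simp add: update_def ts_def acts_def)
    then show "update ts acts ! y = tapes_of w (width p) (\<lambda>_. 0, 0, []) ! y"
      by (auto simp: update_def acts_def ts_def nth_tapes_of scan_def nth_Cons' word_tape_def
          mark_def fun_eq_iff simp del: tapes_of.simps upt_Suc)
  qed (simp add: update_def ts_def acts_def length_tapes_of)
  ultimately show ?thesis by (simp add: init_def ts_def machine_of_def)
qed

text \<open>The cost polynomial is composed with the bound on the iterations; the added
  \<open>1\<close> is the step that writes the marks.\<close>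

theorem poly_time_if_exec:
  fixes b :: "nat poly"
  assumes "\<And>w. w \<in> D \<Longrightarrow> \<exists>c h. exec w (poly b (length w)) p (\<lambda>_. 0, 0, []) (c, h, f w)"
  shows "poly_time_computable_on D f"
proof -
  obtain q :: "nat poly" where q: "cost B p = poly q B" for B
    using cost_poly by blast
  have "outputs_within (machine_of p) w (poly (pcompose q b + 1) (length w)) (f w)" if w: "w \<in> D" for w
  proof -
    obtain c h where e: "exec w (poly b (length w)) p (\<lambda>_. 0, 0, []) (c, h, f w)"
      using assms[OF w] by blast
    let ?M = "machine_of p" and ?R = "width p"
    obtain t where t: "t \<le> poly q (poly b (length w))"
        "(step ?M ^^ t) (1, tapes_of w ?R (\<lambda>_. 0, 0, [])) = (states ?M, tapes_of w ?R (c, h, f w))"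
      using simulation[OF _ _ _ e, of 1 ?M "states ?M" ?R] unfolding q
      by (force simp: machine_of_def)
    \<comment> \<open>Idle steps in the halting state fill up the time to the prescribed
      bound.\<close>
    have halt: "(step ?M ^^ d) (states ?M, ts) = (states ?M, ts)" for d ts
      by (induction d) (simp_all add: step_def)
    define d where "d = poly q (poly b (length w)) - t"
    have "poly (pcompose q b + 1) (length w) = d + t + 1"
      using t(1) by (simp add: d_def poly_pcompose)
    then have "(step ?M ^^ poly (pcompose q b + 1) (length w)) (init ?M w) =
        (states ?M, tapes_of w ?R (c, h, f w))"
      by (simp only: funpow_add o_apply) (simp add: step_init t(2)[simplified] halt)
    then show ?thesis by (simp add: outputs_within_def)
  qed
  then show ?thesis
    unfolding poly_time_computable_on_def using turing_machine_machine_of by blast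
qed


section \<open>Expressions\<close>

declare exec.simps(2,3) [simp del]

section \<open>Composition rules and elementary loops\<close>

lemma exec_SeqI: "exec w B p s s1 \<Longrightarrow> exec w B q s1 s' \<Longrightarrow> exec w B (p ;; q) s s'"
  by (auto simp: exec.simps(2))

lemma exec_Instr_Seq [simp]:
  "exec w B (Instr i ;; p) s s' \<longleftrightarrow> exec w B p (effect w i s) s'"
  by (auto simp: exec.simps(2))

text \<open>A loop is traced through explicit stores \<open>st i\<close> before iteration
  \<open>i\<close>, with an exact number of iterations.\<close>

lemma exec_While:
  assumes "\<And>i. i < n \<Longrightarrow> holds w b (st i) \<and> exec w B p (st i) (st (Suc i))"
    and "\<not> holds w b (st n)" "n \<le> B"
  shows "exec w B (While b p) (st 0) (st n)"
proof -
  have "((\<lambda>r r'. holds w b r \<and> exec w B p r r') ^^ n) (st 0) (st n)"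
    by (rule relpowp_fun_conv[THEN iffD2]) (use assms(1) in blast)
  then show ?thesis using assms by (auto simp: exec.simps(3))
qed

abbreviation clear :: "nat \<Rightarrow> prog" where
  "clear x \<equiv> While (Nonzero x) (Instr (Dec x))"

abbreviation add_to :: "nat \<Rightarrow> nat \<Rightarrow> prog" where
  "add_to x y \<equiv> While (Nonzero x) (Instr (Dec x) ;; Instr (Inc y))"

text \<open>Reading out a counter destroys it; the second loop restores \<open>x\<close> from the
  auxiliary counter \<open>t\<close>.\<close>

abbreviation copy :: "nat \<Rightarrow> nat \<Rightarrow> nat \<Rightarrow> prog" where
  "copy x y t \<equiv> While (Nonzero x) (Instr (Dec x) ;; Instr (Inc y) ;; Instr (Inc t)) ;; add_to t x"

lemma exec_clear:
  assumes "c x \<le> B"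
  shows "exec w B (clear x) (c, h, out) (c(x := 0), h, out)"
proof -
  define st where "st i = (c(x := c x - i), h, out)" for i
  have "exec w B (clear x) (st 0) (st (c x))"
    by (rule exec_While) (use assms in \<open>auto simp: st_def\<close>)
  then show ?thesis by (simp add: st_def)
qed

lemma exec_add_to:
  assumes "c x \<le> B" "x \<noteq> y"
  shows "exec w B (add_to x y) (c, h, out) (c(x := 0, y := c y + c x), h, out)"
proof -
  define st where "st i = (c(x := c x - i, y := c y + i), h, out)" for i
  have "exec w B (add_to x y) (st 0) (st (c x))"
    by (rule exec_While) (use assms in \<open>auto simp: st_def fun_eq_iff\<close>)
  then show ?thesis by (simp add: st_def)
qed

lemma exec_subtract:
  assumes "c x \<le> B" "x \<noteq> y"
  shows "exec w B (While (Nonzero x) (Instr (Dec x) ;; Instr (Dec y))) (c, h, out)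
    (c(x := 0, y := c y - c x), h, out)"
proof -
  define st where "st i = (c(x := c x - i, y := c y - i), h, out)" for i
  have "exec w B (While (Nonzero x) (Instr (Dec x) ;; Instr (Dec y))) (st 0) (st (c x))"
    by (rule exec_While) (use assms in \<open>auto simp: st_def fun_eq_iff\<close>)
  then show ?thesis by (simp add: st_def)
qed

lemma exec_copy:
  assumes "c x \<le> B" "x \<noteq> y" "x \<noteq> t" "y \<noteq> t" "c t = 0"
  shows "exec w B (copy x y t) (c, h, out) (c(y := c y + c x), h, out)"
proof (rule exec_SeqI)
  define st where "st i = (c(x := c x - i, y := c y + i, t := i), h, out)" for i
  have "exec w B (While (Nonzero x) (Instr (Dec x) ;; Instr (Inc y) ;; Instr (Inc t)))
      (st 0) (st (c x))"
    by (rule exec_While) (use assms in \<open>auto simp: st_def fun_eq_iff\<close>)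
  then show "exec w B (While (Nonzero x) (Instr (Dec x) ;; Instr (Inc y) ;; Instr (Inc t)))
      (c, h, out) (c(x := 0, y := c y + c x, t := c x), h, out)"
    using assms(5) by (simp add: st_def fun_upd_idem)
  have "exec w B (add_to t x) (c(x := 0, y := c y + c x, t := c x), h, out)
     ((c(x := 0, y := c y + c x, t := c x))(t := 0, x := 0 + c x), h, out)"
    using exec_add_to[of "c(x := 0, y := c y + c x, t := c x)" t B x w h out] assms by simp
  moreover have "(c(x := 0, y := c y + c x, t := c x))(t := 0, x := 0 + c x) = c(y := c y + c x)"
    using assms by auto
  ultimately show "exec w B (add_to t x) (c(x := 0, y := c y + c x, t := c x), h, out)
      (c(y := c y + c x), h, out)" by simp
qed

section \<open>Arithmetic expressions and their compilation\<close>

datatype exp = Var nat | Const nat | Plus exp exp | Minus exp exp | Times exp exp | Input exp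

text \<open>\<open>I\<close> abstracts from the input: the machine supplies the bits from the
  current head position onwards.\<close>

primrec val :: "(nat \<Rightarrow> bool) \<Rightarrow> exp \<Rightarrow> (nat \<Rightarrow> nat) \<Rightarrow> nat" where
  "val I (Var x) c = c x"
| "val I (Const n) c = n"
| "val I (Plus a b) c = val I a c + val I b c"
| "val I (Minus a b) c = val I a c - val I b c"
| "val I (Times a b) c = val I a c * val I b c"
| "val I (Input a) c = of_bool (I (val I a c))"

primrec vars :: "exp \<Rightarrow> nat set" where
  "vars (Var x) = {x}"
| "vars (Const n) = {}"
| "vars (Plus a b) = vars a \<union> vars b"
| "vars (Minus a b) = vars a \<union> vars b"
| "vars (Times a b) = vars a \<union> vars b"
| "vars (Input a) = vars a"

lemma val_cong: "(\<And>x. x \<in> vars e \<Longrightarrow> c x = c' x) \<Longrightarrow> val I e c = val I e c'"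
  by (induction e) auto

text \<open>A bound for all intermediate values when the variables are at most \<open>V\<close>.\<close>

primrec bound :: "exp \<Rightarrow> nat \<Rightarrow> nat" where
  "bound (Var x) V = V"
| "bound (Const n) V = n"
| "bound (Plus a b) V = bound a V + bound b V"
| "bound (Minus a b) V = bound a V + bound b V"
| "bound (Times a b) V = bound a V + bound b V + bound a V * bound b V"
| "bound (Input a) V = bound a V + 1"

lemma val_le_bound: "(\<And>x. x \<in> vars e \<Longrightarrow> c x \<le> V) \<Longrightarrow> val I e c \<le> bound e V"
proof (induction e)
  case (Times a b)
  then have "val I a c * val I b c \<le> bound a V * bound b V"
    by (intro mult_mono) auto
  then show ?case by simp
qed (auto intro: add_mono le_trans[OF diff_le_self] trans_le_add1)

lemma val_le: "(\<And>x. x \<in> vars e \<Longrightarrow> c x \<le> V) \<Longrightarrow> bound e V \<le> B \<Longrightarrow> val I e c \<le> B"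
  using val_le_bound le_trans by blast

text \<open>The result is left in register \<open>r\<close>; the registers after \<open>r\<close> serve as scratch space.\<close>

primrec compile_exp :: "exp \<Rightarrow> nat \<Rightarrow> prog" where
  "compile_exp (Var x) r = copy x r (r + 1)"
| "compile_exp (Const n) r = ((\<lambda>p. p ;; Instr (Inc r)) ^^ n) (clear r)"
| "compile_exp (Plus a b) r =
     compile_exp a r ;; compile_exp b (r + 1) ;; add_to (r + 1) r"
| "compile_exp (Minus a b) r = compile_exp a r ;; compile_exp b (r + 1) ;;
     While (Nonzero (r + 1)) (Instr (Dec (r + 1)) ;; Instr (Dec r))"
| "compile_exp (Times a b) r = compile_exp a (r + 1) ;; compile_exp b (r + 2) ;;
     While (Nonzero (r + 1)) (Instr (Dec (r + 1)) ;; copy (r + 2) r (r + 3)) ;; clear (r + 2)"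
| "compile_exp (Input a) r = compile_exp a (r + 1) ;;
     While (Nonzero (r + 1)) (Instr (Dec (r + 1)) ;; Instr (Inc (r + 2)) ;; Instr Forward) ;;
     Instr (Sample r) ;;
     While (Nonzero (r + 2)) (Instr (Dec (r + 2)) ;; Instr Backward)"

lemma exec_set:
  assumes "c r \<le> B"
  shows "exec w B (((\<lambda>p. p ;; Instr (Inc r)) ^^ n) (clear r)) (c, h, out) (c(r := n), h, out)"
proof (induction n)
  case 0
  show ?case unfolding funpow_0 using assms by (rule exec_clear)
next
  case (Suc n)
  have "exec w B (Instr (Inc r)) (c(r := n), h, out) (c(r := Suc n), h, out)" by simp
  then have "exec w B (((\<lambda>p. p ;; Instr (Inc r)) ^^ n) (clear r) ;; Instr (Inc r)) (c, h, out)
      (c(r := Suc n), h, out)"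
    by (rule exec_SeqI[OF Suc])
  then show ?case by (simp only: funpow.simps o_apply)
qed

text \<open>Registers from \<open>r\<close> on are zero at the start and, apart from
  \<open>r\<close>, at the end, and the head returns to \<open>h\<close>. Hence one operand can rest
  in a register while the next is evaluated above it. \<open>bound\<close> dominates the bounds of
  the operands, so their loops respect \<open>B\<close> too.\<close>

lemma exec_compile_exp:
  assumes "\<And>x. x \<ge> r \<Longrightarrow> c x = 0" "\<And>x. x \<in> vars e \<Longrightarrow> x < r \<and> c x \<le> V" "bound e V \<le> B"
  shows "exec w B (compile_exp e r) (c, h, out)
    (c(r := val (\<lambda>i. word_tape w (h + int i) = 2) e c), h, out)"
  using assms
proof (induction e arbitrary: r c)
  case (Var x)
  then have "exec w B (copy x r (r + 1)) (c, h, out) (c(r := c r + c x), h, out)"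
    by (intro exec_copy) auto
  moreover have "c r = 0" using Var by simp
  ultimately show ?case unfolding compile_exp.simps val.simps by (simp only: add_0)
next
  case (Const n)
  then show ?case unfolding compile_exp.simps val.simps by (intro exec_set) simp
next
  case (Plus a b)
  let ?v = "\<lambda>e. val (\<lambda>i. word_tape w (h + int i) = 2) e c"
  have a: "exec w B (compile_exp a r) (c, h, out) (c(r := ?v a), h, out)"
    by (rule Plus.IH(1)) (use Plus.prems in force)+
  have eq: "val (\<lambda>i. word_tape w (h + int i) = 2) b (c(r := ?v a)) = ?v b"
    using Plus.prems by (intro val_cong) auto
  have "exec w B (compile_exp b (r + 1)) (c(r := ?v a), h, out)
      (c(r := ?v a, r + 1 := val (\<lambda>i. word_tape w (h + int i) = 2) b (c(r := ?v a))), h, out)"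
    by (rule Plus.IH(2)) (use Plus.prems in force)+
  note b = this[unfolded eq]
  have "?v b \<le> B" by (rule val_le[where V = V]) (use Plus.prems in force)+
  then have "exec w B (add_to (r + 1) r) (c(r := ?v a, r + 1 := ?v b), h, out)
      ((c(r := ?v a, r + 1 := ?v b))(r + 1 := 0, r := ?v a + ?v b), h, out)"
    using exec_add_to[of "c(r := ?v a, r + 1 := ?v b)" "r + 1" B r w h out] by simp
  moreover have "(c(r := ?v a, r + 1 := ?v b))(r + 1 := 0, r := ?v a + ?v b) =
      c(r := ?v (Plus a b))"
    using Plus.prems(1) by auto
  ultimately show ?case
    unfolding compile_exp.simps by (simp only: exec_SeqI[OF a exec_SeqI[OF b]])
next
  case (Minus a b)
  let ?v = "\<lambda>e. val (\<lambda>i. word_tape w (h + int i) = 2) e c"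
  have a: "exec w B (compile_exp a r) (c, h, out) (c(r := ?v a), h, out)"
    by (rule Minus.IH(1)) (use Minus.prems in force)+
  have eq: "val (\<lambda>i. word_tape w (h + int i) = 2) b (c(r := ?v a)) = ?v b"
    using Minus.prems by (intro val_cong) auto
  have "exec w B (compile_exp b (r + 1)) (c(r := ?v a), h, out)
      (c(r := ?v a, r + 1 := val (\<lambda>i. word_tape w (h + int i) = 2) b (c(r := ?v a))), h, out)"
    by (rule Minus.IH(2)) (use Minus.prems in force)+
  note b = this[unfolded eq]
  have "?v b \<le> B" by (rule val_le[where V = V]) (use Minus.prems in force)+
  then have "exec w B (While (Nonzero (r + 1)) (Instr (Dec (r + 1)) ;; Instr (Dec r)))
      (c(r := ?v a, r + 1 := ?v b), h, out)
      ((c(r := ?v a, r + 1 := ?v b))(r + 1 := 0, r := ?v a - ?v b), h, out)"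
    using exec_subtract[of "c(r := ?v a, r + 1 := ?v b)" "r + 1" B r w h out] by simp
  moreover have "(c(r := ?v a, r + 1 := ?v b))(r + 1 := 0, r := ?v a - ?v b) =
      c(r := ?v (Minus a b))"
    using Minus.prems(1) by auto
  ultimately show ?case
    unfolding compile_exp.simps by (simp only: exec_SeqI[OF a exec_SeqI[OF b]])
next
  case (Times a b)
  let ?v = "\<lambda>e. val (\<lambda>i. word_tape w (h + int i) = 2) e c"
  have a: "exec w B (compile_exp a (r + 1)) (c, h, out) (c(r + 1 := ?v a), h, out)"
    by (rule Times.IH(1)) (use Times.prems in force)+
  have eq: "val (\<lambda>i. word_tape w (h + int i) = 2) b (c(r + 1 := ?v a)) = ?v b"
    by (rule val_cong) (use Times.prems in force)
  have "exec w B (compile_exp b (r + 2)) (c(r + 1 := ?v a), h, out)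
      (c(r + 1 := ?v a, r + 2 := val (\<lambda>i. word_tape w (h + int i) = 2) b (c(r + 1 := ?v a))), h, out)"
    by (rule Times.IH(2)) (use Times.prems in force)+
  note b = this[unfolded eq]
  have le: "?v a \<le> B" "?v b \<le> B"
    by (rule val_le[where V = V]; use Times.prems in force)+
  \<comment> \<open>Repeated addition: \<open>r\<close> collects the sum, \<open>r + 1\<close>
    counts down and \<open>r + 2\<close> keeps the summand.\<close>
  define st where "st i = (c(r := i * ?v b, r + 1 := ?v a - i, r + 2 := ?v b), h, out)" for i
  have loop: "exec w B (While (Nonzero (r + 1)) (Instr (Dec (r + 1)) ;; copy (r + 2) r (r + 3)))
      (st 0) (st (?v a))"
  proof (rule exec_While)
    fix i assume i: "i < ?v a"
    have "exec w B (copy (r + 2) r (r + 3))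
      (c(r := i * ?v b, r + 1 := ?v a - Suc i, r + 2 := ?v b), h, out) (st (Suc i))"
      using exec_copy[of "c(r := i * ?v b, r + 1 := ?v a - Suc i, r + 2 := ?v b)"
          "r + 2" B r "r + 3" w h out] le Times.prems(1)
      by (simp add: st_def fun_upd_twist add.commute)
    moreover have "exec w B (Instr (Dec (r + 1))) (st i)
        (c(r := i * ?v b, r + 1 := ?v a - Suc i, r + 2 := ?v b), h, out)"
      by (simp add: st_def fun_upd_twist)
    ultimately show "holds w (Nonzero (r + 1)) (st i) \<and>
        exec w B (Instr (Dec (r + 1)) ;; copy (r + 2) r (r + 3)) (st i) (st (Suc i))"
      using i exec_SeqI by (simp add: st_def)
  qed (use le in \<open>auto simp: st_def\<close>)
  have "st 0 = (c(r + 1 := ?v a, r + 2 := ?v b), h, out)"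
    using Times.prems(1)[of r] by (auto simp: st_def)
  note loop = loop[unfolded this]
  have "exec w B (clear (r + 2)) (st (?v a)) (c(r := ?v (Times a b)), h, out)"
    using exec_clear[of "c(r := ?v a * ?v b, r + 1 := 0, r + 2 := ?v b)" "r + 2" B w h out]
      le Times.prems(1)
    by (simp add: st_def fun_upd_idem fun_upd_twist)
  then show ?case
    unfolding compile_exp.simps by (rule exec_SeqI[OF a exec_SeqI[OF b exec_SeqI[OF loop]]])
next
  case (Input a)
  let ?v = "val (\<lambda>i. word_tape w (h + int i) = 2) a c"
  let ?b = "of_bool (word_tape w (h + int ?v) = 2) :: nat"
  have a: "exec w B (compile_exp a (r + 1)) (c, h, out) (c(r + 1 := ?v), h, out)"
    by (rule Input.IH) (use Input.prems in force)+
  have le: "?v \<le> B" by (rule val_le[where V = V]) (use Input.prems in force)+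
  \<comment> \<open>While the head moves right, the offset migrates from \<open>r + 1\<close> to
    \<open>r + 2\<close>, which then tells how far to go back.\<close>
  define st where "st i = (c(r + 1 := ?v - i, r + 2 := i), h + int i, out)" for i
  have fw: "exec w B (While (Nonzero (r + 1)) (Instr (Dec (r + 1)) ;; Instr (Inc (r + 2)) ;;
      Instr Forward)) (st 0) (st ?v)"
    by (rule exec_While) (use le in \<open>auto simp: st_def fun_eq_iff\<close>)
  have "st 0 = (c(r + 1 := ?v), h, out)"
    using Input.prems(1)[of "r + 2"] by (auto simp: st_def)
  note fw = fw[unfolded this]
  define st' where "st' i = (c(r := ?b, r + 2 := ?v - i), h + int (?v - i), out)" for i
  have sample: "exec w B (Instr (Sample r)) (st ?v) (st' 0)"
    using Input.prems(1) by (auto simp: st_def st'_def fun_eq_iff)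
  have bw: "exec w B (While (Nonzero (r + 2)) (Instr (Dec (r + 2)) ;; Instr Backward))
      (st' 0) (st' ?v)"
    by (rule exec_While) (use le in \<open>auto simp: st'_def fun_eq_iff\<close>)
  have "st' ?v = (c(r := ?b), h, out)"
    using Input.prems(1)[of "r + 2"] by (auto simp: st'_def)
  note bw = bw[unfolded this]
  show ?case
    unfolding compile_exp.simps val.simps
    by (rule exec_SeqI[OF a exec_SeqI[OF fw exec_SeqI[OF sample bw]]])
qed

section \<open>Generators of words\<close>

text \<open>
  The loop \<open>For e g\<close> at level \<open>r\<close> uses variable \<open>r\<close> as index and variable \<open>r + 1\<close> for the number of
  remaining iterations.
\<close>

datatype gen = Digit exp | Cat gen gen | For exp gen

text \<open>The count of remaining iterations is recorded as well, so that the environment agrees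
  with the counters of the running program everywhere.\<close>

primrec emits :: "(nat \<Rightarrow> bool) \<Rightarrow> gen \<Rightarrow> nat \<Rightarrow> (nat \<Rightarrow> nat) \<Rightarrow> bool list" where
  "emits I (Digit e) r c = [val I e c \<noteq> 0]"
| "emits I (Cat g g') r c = emits I g r c @ emits I g' r c"
| "emits I (For e g) r c =
     concat (map (\<lambda>i. emits I g (r + 2) (c(r := i, r + 1 := val I e c - Suc i))) [0..<val I e c])"

primrec wf_gen :: "gen \<Rightarrow> nat \<Rightarrow> bool" where
  "wf_gen (Digit e) r \<longleftrightarrow> vars e \<subseteq> {..<r}"
| "wf_gen (Cat g g') r \<longleftrightarrow> wf_gen g r \<and> wf_gen g' r"
| "wf_gen (For e g) r \<longleftrightarrow> vars e \<subseteq> {..<r} \<and> wf_gen g (r + 2)"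

text \<open>Index and remaining count of a loop become variables of its body, hence the argument
  \<open>V + bound e V\<close>. Nested loops thus compose polynomials.\<close>

primrec gen_bound :: "gen \<Rightarrow> nat \<Rightarrow> nat" where
  "gen_bound (Digit e) V = bound e V"
| "gen_bound (Cat g g') V = gen_bound g V + gen_bound g' V"
| "gen_bound (For e g) V = bound e V + gen_bound g (V + bound e V)"

lemma bound_poly: "\<exists>q :: nat poly. \<forall>V. bound e V = poly q V"
proof (induction e)
  case (Var x)
  have "\<forall>V. bound (Var x) V = poly [:0, 1:] V" by simp
  then show ?case by blast
next
  case (Const n)
  have "\<forall>V. bound (Const n) V = poly [:n:] V" by simp
  then show ?case by blast
next
  case (Plus a b)
  then show ?case by (metis bound.simps(3) poly_add)
next
  case (Minus a b)
  then show ?case by (metis bound.simps(4) poly_add)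
next
  case (Times a b)
  then show ?case by (metis bound.simps(5) poly_add poly_mult)
next
  case (Input a)
  then show ?case by (metis bound.simps(6) poly_add poly_1)
qed

lemma gen_bound_poly: "\<exists>q :: nat poly. \<forall>V. gen_bound g V = poly q V"
proof (induction g)
  case (Digit e)
  then show ?case using bound_poly by simp
next
  case (Cat g g')
  then show ?case by (metis gen_bound.simps(2) poly_add)
next
  case (For e g)
  then obtain q :: "nat poly" where q: "\<forall>V. gen_bound g V = poly q V" by blast
  obtain p :: "nat poly" where p: "\<forall>V. bound e V = poly p V" using bound_poly by blast
  have "\<forall>V. gen_bound (For e g) V = poly (p + pcompose q ([:0, 1:] + p)) V"
    by (simp add: p q poly_pcompose)
  then show ?case by blast
qed

primrec compile_gen :: "gen \<Rightarrow> nat \<Rightarrow> prog" where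
  "compile_gen (Digit e) r = compile_exp e r ;; Instr (Emit r) ;; clear r"
| "compile_gen (Cat g g') r = compile_gen g r ;; compile_gen g' r"
| "compile_gen (For e g) r = compile_exp e (r + 1) ;;
     While (Nonzero (r + 1)) (Instr (Dec (r + 1)) ;; compile_gen g (r + 2) ;; Instr (Inc r)) ;;
     clear r"

text \<open>Counters and head are restored, so consecutive generators start from the same store.
  \<open>V\<close> is kept general because it grows on entering a loop.\<close>

lemma exec_compile_gen:
  assumes "\<And>x. x \<ge> r \<Longrightarrow> c x = 0" "\<And>x. c x \<le> V" "wf_gen g r" "gen_bound g V \<le> B"
  shows "exec w B (compile_gen g r) (c, h, out)
    (c, h, out @ emits (\<lambda>i. word_tape w (h + int i) = 2) g r c)"
  using assms
proof (induction g arbitrary: r c V out)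
  case (Digit e)
  let ?v = "val (\<lambda>i. word_tape w (h + int i) = 2) e c"
  have "exec w B (compile_exp e r) (c, h, out) (c(r := ?v), h, out)"
    by (rule exec_compile_exp) (use Digit in auto)
  moreover have "exec w B (Instr (Emit r)) (c(r := ?v), h, out) (c(r := ?v), h, out @ [?v \<noteq> 0])"
    by simp
  moreover have "?v \<le> B" by (rule val_le[where V = V]) (use Digit.prems in auto)
  then have "exec w B (clear r) (c(r := ?v), h, out @ [?v \<noteq> 0]) (c, h, out @ [?v \<noteq> 0])"
    using exec_clear[of "c(r := ?v)" r B w h "out @ [?v \<noteq> 0]"] Digit.prems(1)[of r]
    by (simp add: fun_upd_idem)
  ultimately show ?case
    unfolding compile_gen.simps emits.simps by (blast intro: exec_SeqI)
next
  case (Cat g g')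
  let ?e = "\<lambda>g. emits (\<lambda>i. word_tape w (h + int i) = 2) g r c"
  have "exec w B (compile_gen g r) (c, h, out) (c, h, out @ ?e g)"
    by (rule Cat.IH(1)[of r c V]) (use Cat.prems in auto)
  moreover have "exec w B (compile_gen g' r) (c, h, out @ ?e g) (c, h, (out @ ?e g) @ ?e g')"
    by (rule Cat.IH(2)[of r c V]) (use Cat.prems in auto)
  ultimately show ?case
    by (simp add: exec_SeqI)
next
  case (For e g)
  let ?I = "\<lambda>i. word_tape w (h + int i) = 2"
  let ?v = "val ?I e c"
  let ?c = "\<lambda>i. c(r := i, r + 1 := ?v - Suc i)"
  let ?out = "\<lambda>i. out @ concat (map (\<lambda>i. emits ?I g (r + 2) (?c i)) [0..<i])"
  have e: "exec w B (compile_exp e (r + 1)) (c, h, out) (c(r + 1 := ?v), h, out)"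
    by (rule exec_compile_exp[where V = V]) (use For.prems in force)+
  have v: "?v \<le> bound e V" using For.prems by (intro val_le_bound)
  then have le: "?v \<le> B" using For.prems by simp
  define st where "st i = (c(r := i, r + 1 := ?v - i), h, ?out i)" for i
  have loop: "exec w B (While (Nonzero (r + 1))
      (Instr (Dec (r + 1)) ;; compile_gen g (r + 2) ;; Instr (Inc r))) (st 0) (st ?v)"
  proof (rule exec_While)
    fix i assume i: "i < ?v"
    have "exec w B (Instr (Dec (r + 1))) (st i) (?c i, h, ?out i)"
      by (simp add: st_def)
    moreover have "exec w B (compile_gen g (r + 2)) (?c i, h, ?out i) (?c i, h, ?out (Suc i))"
    proof -
      have "c x \<le> V + bound e V" for x using For.prems(2)[of x] by simp
      then have "exec w B (compile_gen g (r + 2)) (?c i, h, ?out i)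
          (?c i, h, ?out i @ emits ?I g (r + 2) (?c i))"
        by (intro For.IH[of "r + 2" "?c i" "V + bound e V"]) (use For.prems i v in auto)
      then show ?thesis by simp
    qed
    moreover have "exec w B (Instr (Inc r)) (?c i, h, ?out (Suc i)) (st (Suc i))"
      by (simp add: st_def fun_upd_twist)
    ultimately show "holds w (Nonzero (r + 1)) (st i) \<and> exec w B
        (Instr (Dec (r + 1)) ;; compile_gen g (r + 2) ;; Instr (Inc r)) (st i) (st (Suc i))"
      using i exec_SeqI by (metis (no_types, lifting) fun_upd_same holds.simps(1) st_def
          zero_less_diff less_irrefl)
  qed (use le in \<open>auto simp: st_def\<close>)
  have "st 0 = (c(r + 1 := ?v), h, out)"
    using For.prems(1)[of r] by (auto simp: st_def)
  note loop = loop[unfolded this]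
  have "exec w B (clear r) (st ?v) (c, h, out @ emits ?I (For e g) r c)"
    using exec_clear[of "c(r := ?v, r + 1 := 0)" r B w h "?out ?v"] le For.prems(1)
    by (simp add: st_def fun_upd_idem fun_upd_twist)
  then show ?case
    unfolding compile_gen.simps by (rule exec_SeqI[OF e exec_SeqI[OF loop]])
qed

section \<open>Reading the parameters\<close>

definition lead :: "bool list \<Rightarrow> nat" where
  "lead w = length (takeWhile id w)"

lemma lead_unary [simp]: "lead (unary n @ u) = n"
proof -
  have "takeWhile id (replicate n True @ False # u) = replicate n True"
    by (induction n) auto
  then show ?thesis by (simp add: lead_def unary_def)
qed

lemma length_unary [simp]: "length (unary n) = Suc n"
  by (simp add: unary_def)

definition params :: "nat \<Rightarrow> nat \<Rightarrow> nat \<Rightarrow> nat \<Rightarrow> nat" where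
  "params n m k = (\<lambda>_. 0)(0 := n, 1 := m, 2 := k)"

text \<open>The parameters take variables \<open>0\<close>, \<open>1\<close>, \<open>2\<close>, so
  generators start at level \<open>3\<close>. Each \<open>Suc\<close> skips the \<open>False\<close>
  that ends a unary number.\<close>

definition run_gen :: "gen \<Rightarrow> bool list \<Rightarrow> bool list" where
  "run_gen g w =
     (let n = lead w; u = drop (Suc n) w; m = lead u; v = drop (Suc m) u; k = lead v;
          bs = drop (Suc k) v
      in emits (\<lambda>i. i < length bs \<and> bs ! i) g 3 (params n m k))"

lemma run_gen_unary:
  "run_gen g (unary n @ unary m @ unary k @ bs) =
    emits (\<lambda>i. i < length bs \<and> bs ! i) g 3 (params n m k)"
  by (simp add: run_gen_def)

abbreviation read_unary :: "nat \<Rightarrow> prog" where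
  "read_unary x \<equiv> While Bit (Instr Forward ;; Instr (Inc x)) ;; Instr Forward"

lemma exec_read_unary:
  assumes "w = u @ unary a @ v" "h = int (length u)" "c x = 0" "a \<le> B"
  shows "exec w B (read_unary x) (c, h, out) (c(x := a), h + int (Suc a), out)"
proof (rule exec_SeqI)
  define st where "st i = (c(x := i), h + int i, out)" for i
  have bit: "word_tape w (h + int i) = 2 \<longleftrightarrow> i < a" if "i \<le> a" for i
    using that assms(1,2) by (auto simp: word_tape_def unary_def nth_append nat_add_distrib)
  have "exec w B (While Bit (Instr Forward ;; Instr (Inc x))) (st 0) (st a)"
    by (rule exec_While) (use assms(4) in \<open>auto simp: st_def bit\<close>)
  moreover have "st 0 = (c, h, out)" using assms(3) by (auto simp: st_def)
  ultimately show "exec w B (While Bit (Instr Forward ;; Instr (Inc x))) (c, h, out)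
      (c(x := a), h + int a, out)" by (simp add: st_def)
qed simp

theorem poly_time_run_gen:
  assumes "wf_gen g 3" "\<And>w. w \<in> D \<Longrightarrow> \<exists>n m k bs. w = unary n @ unary m @ unary k @ bs"
  shows "poly_time_computable_on D (run_gen g)"
proof -
  let ?p = "read_unary 0 ;; read_unary 1 ;; read_unary 2 ;; compile_gen g 3"
  obtain r :: "nat poly" where r: "gen_bound g V = poly r V" for V
    using gen_bound_poly by blast
  \<comment> \<open>\<open>[:0, 1:]\<close> is the length of the word and limits the reading loops,
    as the unary parameters are part of the word; \<open>r\<close> limits the generator.\<close>
  show ?thesis
  proof (rule poly_time_if_exec[where b = "[:0, 1:] + r" and p = ?p])
    fix w assume "w \<in> D"
    then obtain n m k bs where w: "w = unary n @ unary m @ unary k @ bs" using assms(2) by blast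
    let ?B = "poly ([:0, 1:] + r) (length w)"
    let ?c1 = "(\<lambda>_. 0)(0 := n)" and ?c2 = "(\<lambda>_. 0)(0 := n, 1 := m)"
    let ?h1 = "0 + int (Suc n)" and ?h2 = "0 + int (Suc n) + int (Suc m)"
    let ?h3 = "0 + int (Suc n) + int (Suc m) + int (Suc k)"
    have le: "n \<le> ?B" "m \<le> ?B" "k \<le> ?B" "gen_bound g (length w) \<le> ?B"
      by (simp_all add: w r)
    have 1: "exec w ?B (read_unary 0) (\<lambda>_. 0, 0, []) (?c1, ?h1, [])"
      by (rule exec_read_unary[where u = "[]"]) (use le in \<open>simp_all add: w\<close>)
    have 2: "exec w ?B (read_unary 1) (?c1, ?h1, []) (?c2, ?h2, [])"
      by (rule exec_read_unary[where u = "unary n"]) (use le in \<open>simp_all add: w\<close>)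
    have 3: "exec w ?B (read_unary 2) (?c2, ?h2, []) (params n m k, ?h3, [])"
      unfolding params_def
      by (rule exec_read_unary[where u = "unary n @ unary m"]) (use le in \<open>simp_all add: w\<close>)
    have 4: "exec w ?B (compile_gen g 3) (params n m k, ?h3, []) (params n m k, ?h3,
        [] @ emits (\<lambda>i. word_tape w (?h3 + int i) = 2) g 3 (params n m k))"
      by (rule exec_compile_gen[where V = "length w"])
        (use le assms(1) in \<open>auto simp: params_def w\<close>)
    \<comment> \<open>After the parameters are read, the head stands on the first entry of
      \<open>bs\<close>.\<close>
    have "word_tape w (?h3 + int i) = 2 \<longleftrightarrow> i < length bs \<and> bs ! i" for i
    proof -
      have "nat (?h3 + int i) = length (unary n @ unary m @ unary k) + i" by simp
      moreover have "w = (unary n @ unary m @ unary k) @ bs" by (simp add: w)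
      ultimately have "w ! nat (?h3 + int i) = bs ! i" by (metis nth_append_length_plus)
      then show ?thesis by (auto simp: word_tape_def w)
    qed
    then have "[] @ emits (\<lambda>i. word_tape w (?h3 + int i) = 2) g 3 (params n m k) = run_gen g w"
      unfolding w run_gen_unary by simp
    note 4 = 4[unfolded this]
    show "\<exists>c h. exec w ?B ?p (\<lambda>_. 0, 0, []) (c, h, run_gen g w)"
      using exec_SeqI[OF 1 exec_SeqI[OF 2 exec_SeqI[OF 3 4]]] by blast
  qed
qed

section \<open>Distances and diameters\<close>

text \<open>If no walk has length at most \<open>d\<close>, then \<open>d + 1\<close> bounds all
  lengths from below, also when there is no walk and the infimum is \<infinity>.\<close>

lemma graph_dist_le_iff:
  "graph_dist E u v \<le> enat d \<longleftrightarrow> (\<exists>n\<le>d. (u, v) \<in> {(x, y). {x, y} \<in> E} ^^ n)"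
proof
  assume le: "graph_dist E u v \<le> enat d"
  show "\<exists>n\<le>d. (u, v) \<in> {(x, y). {x, y} \<in> E} ^^ n"
  proof (rule ccontr)
    assume "\<not> ?thesis"
    then have "enat (Suc d) \<le> graph_dist E u v"
      unfolding graph_dist_def by (intro INF_greatest) (auto simp: not_le Suc_le_eq)
    then have "enat (Suc d) \<le> enat d" using le by (rule order_trans)
    then show False by simp
  qed
next
  assume "\<exists>n\<le>d. (u, v) \<in> {(x, y). {x, y} \<in> E} ^^ n"
  then show "graph_dist E u v \<le> enat d"
    unfolding graph_dist_def by (auto intro!: INF_lower2)
qed

lemma graph_dist_le_2_iff:
  "graph_dist E u v \<le> enat 2 \<longleftrightarrow> u = v \<or> {u, v} \<in> E \<or> (\<exists>x. {u, x} \<in> E \<and> {x, v} \<in> E)"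
proof -
  have *: "(\<exists>n\<le>2. P n) \<longleftrightarrow> P 0 \<or> P (Suc 0) \<or> P (Suc (Suc 0))" for P :: "nat \<Rightarrow> bool"
    by (auto simp: le_Suc_eq numeral_2_eq_2)
  show ?thesis unfolding graph_dist_le_iff * by auto
qed

lemma graph_dist_le_3:
  assumes "{u, x} \<in> E" "{x, y} \<in> E" "{y, v} \<in> E"
  shows "graph_dist E u v \<le> enat 3"
proof -
  have "(u, v) \<in> {(x, y). {x, y} \<in> E} ^^ 3"
    using assms by (auto simp: numeral_3_eq_3)
  then show ?thesis unfolding graph_dist_le_iff by blast
qed

lemma graph_diameter_le_iff:
  "graph_diameter V E \<le> d \<longleftrightarrow> (\<forall>u\<in>V. \<forall>v\<in>V. graph_dist E u v \<le> d)"
  by (simp add: graph_diameter_def SUP_le_iff)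

lemma graph_dist_le_graph_diameter:
  "u \<in> V \<Longrightarrow> v \<in> V \<Longrightarrow> graph_dist E u v \<le> graph_diameter V E"
  using graph_diameter_le_iff[of V E "graph_diameter V E"] by simp


section \<open>The graph of the reduction\<close>

lemma distinct_concat_map:
  assumes "distinct xs" "\<And>x. x \<in> set xs \<Longrightarrow> distinct (f x)"
    and "\<And>x y. x \<in> set xs \<Longrightarrow> y \<in> set xs \<Longrightarrow> x \<noteq> y \<Longrightarrow> set (f x) \<inter> set (f y) = {}"
  shows "distinct (concat (map f xs))"
  using assms
proof (induction xs)
  case (Cons x xs)
  then have "distinct (concat (map f xs))" by simp
  moreover have "set (f x) \<inter> set (f y) = {}" if "y \<in> set xs" for y
    using Cons.prems that by auto
  ultimately show ?case using Cons.prems by auto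
qed simp

text \<open>
  Vertices \<open>Family j\<close> with \<open>j < m\<close> are the members of the family. An additional element \<open>n\<close>
  belongs to all of them, so that the base set is never empty, and \<open>Family m\<close> is an additional set
  \<open>{n}\<close>. \<open>Family (m + 2)\<close> is the root whose distance to the points is to be decreased, and
  \<open>Family (m + 1)\<close> is its only neighbour. The element \<open>i\<close> is represented by a grid of points
  \<open>Point i a b\<close>; all points in column \<open>b = 2 * k + 1\<close> are neighbours of every vertex \<open>Family j\<close>
  but the root, so they are at distance \<open>2\<close> of the root.
\<close>

datatype vertex = Family nat | Point nat nat nat

instance vertex :: countable
  by countable_datatype

locale gadget =
  fixes n m k :: nat and I :: "nat \<Rightarrow> bool"
begin

abbreviation q :: nat where
  "q \<equiv> 2 * k + 1"

text \<open>\<open>j * n + i\<close> is the position of row \<open>j\<close>, column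
  \<open>i\<close> in the incidence matrix written row by row.\<close>

definition member :: "nat \<Rightarrow> nat \<Rightarrow> bool" where
  "member j i \<longleftrightarrow> j \<le> m \<and> i = n \<or> j < m \<and> i < n \<and> I (j * n + i)"

fun adj :: "vertex \<Rightarrow> vertex \<Rightarrow> bool" where
  "adj (Family j) (Family j') \<longleftrightarrow>
     j \<noteq> j' \<and> (j = m + 1 \<or> j' = m + 1 \<or> j \<noteq> m + 2 \<and> j' \<noteq> m + 2)"
| "adj (Family j) (Point i a b) \<longleftrightarrow> j \<noteq> m + 2 \<and> (b = q \<or> member j i)"
| "adj (Point i a b) (Family j) \<longleftrightarrow> j \<noteq> m + 2 \<and> (b = q \<or> member j i)"
| "adj (Point i a b) (Point i' a' b') \<longleftrightarrow>
     \<not> (i = i' \<and> a = a' \<and> b = b') \<and> (a = a' \<or> b = b')"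

lemma adj_commute: "adj x y \<longleftrightarrow> adj y x"
  by (cases x; cases y) auto

lemma adj_irrefl: "\<not> adj x x"
  by (cases x) auto

text \<open>The order is that of the loops in \<open>for_vertices\<close>, since it determines the
  adjacency matrix.\<close>

definition vertices :: "vertex list" where
  "vertices = map Family [0..<m + 3] @
     concat (map (\<lambda>i. concat (map (\<lambda>a. map (Point i a) [0..<q + 1]) [0..<q])) [0..<n + 1])"

lemma Family_in_vertices [simp]: "Family j \<in> set vertices \<longleftrightarrow> j < m + 3"
  by (auto simp: vertices_def simp del: upt_Suc)

lemma Point_in_vertices [simp]: "Point i a b \<in> set vertices \<longleftrightarrow> i \<le> n \<and> a < q \<and> b \<le> q"
  by (auto simp: vertices_def image_iff less_Suc_eq_le simp del: upt_Suc)

lemma distinct_vertices: "distinct vertices"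
proof -
  have "distinct (concat (map (\<lambda>a. map (Point i a) [0..<q + 1]) [0..<q]))" for i
    by (rule distinct_concat_map) (auto simp: distinct_map inj_on_def simp del: upt_Suc)
  then have "distinct (concat
      (map (\<lambda>i. concat (map (\<lambda>a. map (Point i a) [0..<q + 1]) [0..<q])) [0..<n + 1]))"
    by (rule distinct_concat_map[rotated]) (auto simp del: upt_Suc)
  then show ?thesis
    unfolding vertices_def distinct_append
    by (auto simp: distinct_map inj_on_def simp del: upt_Suc)
qed

lemma length_vertices: "length vertices = (m + 3) + (n + 1) * (q * (q + 1))"
  by (simp add: vertices_def length_concat comp_def sum_list_triv del: upt_Suc)

abbreviation V :: "nat set" where
  "V \<equiv> to_nat ` set vertices"

definition E :: "nat set set" where
  "E = {{to_nat x, to_nat y} |x y. x \<in> set vertices \<and> y \<in> set vertices \<and> adj x y}"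

lemma edge_iff:
  "{to_nat x, to_nat y} \<in> E \<longleftrightarrow> x \<in> set vertices \<and> y \<in> set vertices \<and> adj x y"
  unfolding E_def using adj_commute by (auto simp: doubleton_eq_iff)

lemma ugraph_gadget: "ugraph V E"
  unfolding ugraph_def E_def by (auto simp: adj_irrefl)

section \<open>Distances in the gadget\<close>

definition near :: "vertex \<Rightarrow> vertex \<Rightarrow> bool" where
  "near x y \<longleftrightarrow> x = y \<or> adj x y \<or> (\<exists>z\<in>set vertices. adj x z \<and> adj z y)"

lemma near_commute: "near x y \<longleftrightarrow> near y x"
  unfolding near_def using adj_commute by blast

lemma dist_le_2_iff_near:
  assumes "x \<in> set vertices" "y \<in> set vertices"
  shows "graph_dist E (to_nat x) (to_nat y) \<le> enat 2 \<longleftrightarrow> near x y"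
proof -
  have "(\<exists>v. {to_nat x, v} \<in> E \<and> {v, to_nat y} \<in> E) \<longleftrightarrow>
      (\<exists>z\<in>set vertices. adj x z \<and> adj z y)"
  proof
    assume "\<exists>v. {to_nat x, v} \<in> E \<and> {v, to_nat y} \<in> E"
    then obtain v where v: "{to_nat x, v} \<in> E" "{v, to_nat y} \<in> E" by blast
    from v(1) obtain z :: vertex where "v = to_nat z"
      unfolding E_def by (auto simp: doubleton_eq_iff)
    then show "\<exists>z\<in>set vertices. adj x z \<and> adj z y" using v edge_iff by auto
  qed (use assms edge_iff in blast)
  then show ?thesis unfolding graph_dist_le_2_iff near_def by (simp add: edge_iff assms)
qed

text \<open>The only neighbour of the root is \<open>Family (m + 1)\<close>, which has no members
  and so sees points of column \<open>q\<close> only. Any other \<open>Family\<close> vertex reaches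
  the point through \<open>Point i a q\<close> in the same row.\<close>

lemma near_Family_Point:
  assumes "j < m + 3" "i \<le> n" "a < q" "b \<le> q"
  shows "near (Family j) (Point i a b) \<longleftrightarrow> j \<noteq> m + 2 \<or> b = q"
proof (cases "j = m + 2")
  case True
  have "z = Family (m + 1)" if "z \<in> set vertices" "adj (Family (m + 2)) z" for z
    using that(2) by (cases z) auto
  moreover have "Family (m + 1) \<in> set vertices" "adj (Family (m + 2)) (Family (m + 1))" by simp_all
  moreover have "adj (Family (m + 1)) (Point i a b) \<longleftrightarrow> b = q" by (simp add: member_def)
  moreover have "adj (Family (m + 2)) (Point i a b) \<longleftrightarrow> False" by simp
  ultimately show ?thesis unfolding True near_def by blast
next
  case False
  have "Point i a q \<in> set vertices" using assms by simp
  moreover have "adj (Family j) (Point i a q)" using False by simp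
  moreover have "b = q \<or> adj (Point i a q) (Point i a b)" by auto
  ultimately show ?thesis using False unfolding near_def by blast
qed

lemma near_Family_Family:
  assumes "j < m + 3" "j' < m + 3"
  shows "near (Family j) (Family j')"
proof -
  have "Family (m + 1) \<in> set vertices" by simp
  moreover have "j = m + 1 \<or> adj (Family j) (Family (m + 1))"
    "j' = m + 1 \<or> adj (Family (m + 1)) (Family j')" by auto
  ultimately show ?thesis unfolding near_def by blast
qed

text \<open>The row of the first point meets the column of the second in
  \<open>Point i a b'\<close>.\<close>

lemma near_Point_Point:
  assumes "i \<le> n" "a < q" "b \<le> q" "i' \<le> n" "a' < q" "b' \<le> q"
  shows "near (Point i a b) (Point i' a' b')"
proof -
  have "Point i a b' \<in> set vertices" using assms by simp
  moreover have "b = b' \<or> adj (Point i a b) (Point i a b')" by auto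
  moreover have "Point i a b' = Point i' a' b' \<or> adj (Point i a b') (Point i' a' b')" by auto
  ultimately show ?thesis unfolding near_def by blast
qed

text \<open>The diameter bounds before and after augmentation both reduce to these cases.\<close>

lemma near_or_root:
  assumes "x \<in> set vertices" "y \<in> set vertices"
  obtains "near x y"
  | i a b where "x = Family (m + 2)" "y = Point i a b" "i \<le> n" "a < q" "b < q"
  | i a b where "y = Family (m + 2)" "x = Point i a b" "i \<le> n" "a < q" "b < q"
proof (cases x)
  case (Family j)
  show thesis
  proof (cases y)
    case (Family j')
    then show thesis using \<open>x = Family j\<close> assms near_Family_Family that by simp
  next
    case (Point i a b)
    then show thesis using \<open>x = Family j\<close> assms near_Family_Point[of j i a b] that
      by (cases "b = q") auto
  qed
next
  case (Point i a b)
  show thesis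
  proof (cases y)
    case (Family j)
    then show thesis using Point assms near_Family_Point[of j i a b] that near_commute
      by (cases "b = q") auto
  next
    case (Point i' a' b')
    then show thesis using \<open>x = Point i a b\<close> assms near_Point_Point that by simp
  qed
qed

lemma diameter_gadget: "graph_diameter V E = 3"
proof (rule antisym)
  have root: "graph_dist E (to_nat (Family (m + 2))) (to_nat (Point i a b)) \<le> enat 3"
    "graph_dist E (to_nat (Point i a b)) (to_nat (Family (m + 2))) \<le> enat 3"
    if "i \<le> n" "a < q" "b < q" for i a b
  proof -
    show "graph_dist E (to_nat (Family (m + 2))) (to_nat (Point i a b)) \<le> enat 3"
      by (rule graph_dist_le_3[of _ "to_nat (Family (m + 1))" _ "to_nat (Point i a q)"])
        (use that in \<open>auto simp: edge_iff\<close>)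
    show "graph_dist E (to_nat (Point i a b)) (to_nat (Family (m + 2))) \<le> enat 3"
      by (rule graph_dist_le_3[of _ "to_nat (Point i a q)" _ "to_nat (Family (m + 1))"])
        (use that in \<open>auto simp: edge_iff\<close>)
  qed
  have "graph_dist E (to_nat x) (to_nat y) \<le> enat 3"
    if xy: "x \<in> set vertices" "y \<in> set vertices" for x y
    using xy
  proof (cases rule: near_or_root)
    case 1
    then have "graph_dist E (to_nat x) (to_nat y) \<le> enat 2" using dist_le_2_iff_near xy by simp
    also have "enat 2 \<le> enat 3" by simp
    finally show ?thesis .
  next
    case (2 i a b)
    then show ?thesis using root by simp
  next
    case (3 i a b)
    then show ?thesis using root by simp
  qed
  then show "graph_diameter V E \<le> 3"
    by (auto simp: graph_diameter_le_iff numeral_eq_enat)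
  \<comment> \<open>By the additional element \<open>n\<close> and \<open>q > 0\<close>, this point
    exists and lies outside column \<open>q\<close> for all parameters.\<close>
  have "\<not> near (Family (m + 2)) (Point n 0 0)"
    using near_Family_Point[of "m + 2" n 0 0] by simp
  then have "enat 2 < graph_dist E (to_nat (Family (m + 2))) (to_nat (Point n 0 0))"
    using dist_le_2_iff_near[of "Family (m + 2)" "Point n 0 0"] by (simp add: not_le)
  also have "\<dots> \<le> graph_diameter V E"
    by (rule graph_dist_le_graph_diameter) auto
  finally have "eSuc (enat 2) \<le> graph_diameter V E" by (rule ileI1)
  then show "3 \<le> graph_diameter V E" by (simp add: eSuc_enat numeral_eq_enat)
qed

section \<open>Covers and augmentations\<close>

lemma u_bcmd_if_cover:
  assumes "J \<subseteq> {..m}" "card J \<le> k" "\<And>i. i \<le> n \<Longrightarrow> \<exists>j\<in>J. member j i"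
  shows "u_bcmd V E k 2"
proof -
  \<comment> \<open>The root is joined to the chosen sets. These edges are new, as its only old
    neighbour \<open>Family (m + 1)\<close> is not among them.\<close>
  define F where "F = (\<lambda>j. {to_nat (Family (m + 2)), to_nat (Family j)}) ` J"
  have "F \<subseteq> [V]\<^bsup>2\<^esup> - E"
    using assms(1) by (auto simp: F_def edge_iff)
  moreover have "card F \<le> k"
    using card_image_le[of J] assms(1,2) finite_subset[OF assms(1)] unfolding F_def
    by (meson finite_atMost le_trans)
  moreover have "graph_diameter V (E \<union> F) \<le> enat 2"
  proof -
    have "graph_dist (E \<union> F) (to_nat x) (to_nat y) \<le> enat 2"
      if xy: "x \<in> set vertices" "y \<in> set vertices" for x y
    proof -
      have root: "\<exists>v. {to_nat (Family (m + 2)), v} \<in> E \<union> F \<and> {v, to_nat (Point i a b)} \<in> E \<union> F"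
        if i: "i \<le> n" "a < q" "b < q" for i a b
      proof -
        obtain j where j: "j \<in> J" "member j i" using assms(3) i(1) by blast
        then have "{to_nat (Family (m + 2)), to_nat (Family j)} \<in> F" by (auto simp: F_def)
        moreover have "{to_nat (Family j), to_nat (Point i a b)} \<in> E"
          using j i assms(1) by (auto simp: edge_iff)
        ultimately show ?thesis by blast
      qed
      from xy show ?thesis
      proof (cases rule: near_or_root)
        case 1
        then have "graph_dist E (to_nat x) (to_nat y) \<le> enat 2" using dist_le_2_iff_near xy by simp
        then show ?thesis unfolding graph_dist_le_2_iff by blast
      next
        case (2 i a b)
        then show ?thesis using root[of i a b] unfolding graph_dist_le_2_iff by simp
      next
        case (3 i a b)
        then show ?thesis using root[of i a b] unfolding graph_dist_le_2_iff
          by (metis insert_commute)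
      qed
    qed
    then show ?thesis by (auto simp: graph_diameter_le_iff)
  qed
  ultimately show ?thesis unfolding u_bcmd_def by blast
qed

text \<open>
  At most \<open>2 * k\<close> vertices are incident with new edges, so for some \<open>a, b < 2 * k + 1\<close> the new
  edges avoid row \<open>a\<close> and column \<open>b\<close> of all grids. Then the root can only get close to \<open>Point i a b\<close>
  by a new edge to a set that contains \<open>i\<close>.
\<close>

lemma cover_if_u_bcmd:
  assumes "u_bcmd V E k 2"
  shows "\<exists>J\<subseteq>{..m}. card J \<le> k \<and> (\<forall>i\<le>n. \<exists>j\<in>J. member j i)"
proof -
  obtain F where F: "F \<subseteq> [V]\<^bsup>2\<^esup> - E" "card F \<le> k" "graph_diameter V (E \<union> F) \<le> enat 2"
    using assms unfolding u_bcmd_def by blast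
  have "finite ([V]\<^bsup>2\<^esup>)" by (rule finite_imp_finite_nsets) simp
  then have fin: "finite F" using F(1) finite_subset by blast
  have card2: "finite e \<and> card e = 2" if "e \<in> F" for e
    using F(1) that by (auto simp: nsets_def)
  have "card (\<Union>F) \<le> (\<Sum>e\<in>F. card e)" using card2 by (intro card_Union_le_sum_card)
  also have "\<dots> = 2 * card F" using card2 by simp
  finally have touched: "card (\<Union>F) < q" using F(2) by simp
  \<comment> \<open>\<open>g\<close> reads off a row or a column. If all values below
    \<open>q\<close> occurred at endpoints of new edges, there would be at least \<open>q\<close>
    endpoints.\<close>
  have avoid: "\<exists>a<q. \<forall>x. to_nat x \<in> \<Union>F \<longrightarrow> g x \<noteq> a" for g :: "vertex \<Rightarrow> nat"
  proof (rule ccontr)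
    assume "\<not> ?thesis"
    then have "{..<q} \<subseteq> (g \<circ> from_nat) ` \<Union>F" by (force simp: image_iff)
    moreover have "finite (\<Union>F)" using fin card2 by blast
    ultimately have "q \<le> card (\<Union>F)"
      by (metis card_lessThan finite_imageI card_image_le card_mono le_trans)
    then show False using touched by simp
  qed
  \<comment> \<open>\<open>Family\<close> vertices get the arbitrary value \<open>0\<close>; the
    count of endpoints includes them anyway.\<close>
  obtain a where a: "a < q" "\<And>i b. to_nat (Point i a b) \<notin> \<Union>F"
    using avoid[of "\<lambda>x. case x of Point i a b \<Rightarrow> a | Family j \<Rightarrow> 0"] by fastforce
  obtain b where b: "b < q" "\<And>i a. to_nat (Point i a b) \<notin> \<Union>F"
    using avoid[of "\<lambda>x. case x of Point i a b \<Rightarrow> b | Family j \<Rightarrow> 0"] by fastforce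
  let ?u = "Family (m + 2)"
  define J where "J = {j. j \<le> m \<and> {to_nat ?u, to_nat (Family j)} \<in> F}"
  have "card J \<le> card F"
    by (rule card_inj_on_le[of "\<lambda>j. {to_nat ?u, to_nat (Family j)}"])
      (auto simp: inj_on_def doubleton_eq_iff J_def fin)
  moreover have "\<exists>j\<in>J. member j i" if i: "i \<le> n" for i
  proof -
    let ?p = "Point i a b"
    have "graph_dist (E \<union> F) (to_nat ?u) (to_nat ?p) \<le> enat 2"
      using F(3) a b i by (auto simp: graph_diameter_le_iff)
    moreover have "{to_nat ?u, to_nat ?p} \<notin> E \<union> F" using a(2)[of i b] by (auto simp: edge_iff)
    ultimately obtain v where v: "{to_nat ?u, v} \<in> E \<union> F" "{v, to_nat ?p} \<in> E \<union> F"
      unfolding graph_dist_le_2_iff by auto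
    \<comment> \<open>Row \<open>a\<close> is untouched, so the second edge of the path is
      old.\<close>
    have vE: "{v, to_nat ?p} \<in> E" using v(2) a(2)[of i b] by auto
    then obtain z :: vertex where z: "v = to_nat z" unfolding E_def by (auto simp: doubleton_eq_iff)
    then have zp: "adj z ?p" "z \<in> set vertices" using vE by (auto simp: edge_iff)
    \<comment> \<open>Two old edges would make the root near \<open>?p\<close>, so the first edge is
      new.\<close>
    have "\<not> near ?u ?p" using near_Family_Point[of "m + 2" i a b] a b i by simp
    then have "{to_nat ?u, v} \<notin> E" using z zp by (auto simp: edge_iff near_def)
    then have new: "{to_nat ?u, to_nat z} \<in> F" using v(1) z by simp
    show ?thesis
    proof (cases z)
      case (Family j)
      then have "member j i" using zp b(1) by auto
      moreover have "j \<le> m" using \<open>member j i\<close> by (auto simp: member_def)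
      ultimately show ?thesis using new Family by (auto simp: J_def)
    next
      \<comment> \<open>A point adjacent to \<open>?p\<close> lies in row \<open>a\<close> or column
        \<open>b\<close>, which new edges avoid.\<close>
      case (Point i' a' b')
      then have "to_nat (Point i' a' b') \<in> \<Union>F" using new by auto
      then show ?thesis using zp Point a(2) b(2) by auto
    qed
  qed
  moreover have "J \<subseteq> {..m}" by (auto simp: J_def)
  ultimately show ?thesis using F(2) le_trans by blast
qed

text \<open>If \<open>S\<close> is nonempty, so is every cover, and any of its sets contains the
  additional element \<open>n\<close>. If \<open>S\<close> is empty, the additional set
  \<open>m\<close> has to be chosen, which requires \<open>k \<noteq> 0\<close>.\<close>

lemma set_cover_iff_u_bcmd:
  assumes inst: "set_cover_instance S X" and xs: "distinct xs" "set xs = S" "length xs = n"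
    and Ys: "distinct Ys" "set Ys = X" "length Ys = m"
    and I: "\<And>j i. j < m \<Longrightarrow> i < n \<Longrightarrow> I (j * n + i) \<longleftrightarrow> xs ! i \<in> Ys ! j"
    and nontrivial: "S \<noteq> {} \<or> k \<noteq> 0"
  shows "set_cover S X k \<longleftrightarrow> u_bcmd V E k 2"
proof
  assume "set_cover S X k"
  then obtain C where C: "C \<subseteq> X" "card C \<le> k" "\<Union>C = S" unfolding set_cover_def by blast
  show "u_bcmd V E k 2"
  proof (cases "S = {}")
    case True
    then have "member m i" if "i \<le> n" for i
      unfolding member_def using that xs True by auto
    then show ?thesis
      using nontrivial True by (intro u_bcmd_if_cover[of "{m}"]) auto
  next
    case False
    define J where "J = {j. j < m \<and> Ys ! j \<in> C}"
    have index: "\<exists>j\<in>J. Ys ! j = Y" if Y: "Y \<in> C" for Y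
    proof -
      have "Y \<in> set Ys" using Y C(1) Ys(2) by blast
      then obtain j where "j < m" "Ys ! j = Y" unfolding in_set_conv_nth Ys(3) by blast
      then show ?thesis using Y by (auto simp: J_def)
    qed
    have "finite C" using C(1) Ys finite_subset by blast
    then have "card J \<le> card C"
      by (intro card_inj_on_le[of "(!) Ys"])
        (auto simp: J_def inj_on_def nth_eq_iff_index_eq Ys)
    moreover have "\<exists>j\<in>J. member j i" if "i \<le> n" for i
    proof (cases "i = n")
      case True
      obtain Y where "Y \<in> C" using False C(3) by blast
      then obtain j where "j \<in> J" using index by blast
      then show ?thesis using True by (auto simp: member_def J_def)
    next
      case False
      then have i: "i < n" using that by simp
      then have "xs ! i \<in> \<Union>C" using xs C(3) by auto
      then obtain j where "j \<in> J" "xs ! i \<in> Ys ! j" using index by blast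
      then show ?thesis using i I by (auto simp: member_def J_def)
    qed
    ultimately show ?thesis
      using C(2) by (intro u_bcmd_if_cover[of J]) (auto simp: J_def)
  qed
next
  assume "u_bcmd V E k 2"
  then obtain J where J: "J \<subseteq> {..m}" "card J \<le> k" "\<And>i. i \<le> n \<Longrightarrow> \<exists>j\<in>J. member j i"
    using cover_if_u_bcmd by blast
  have fin: "finite J" using J(1) finite_subset by blast
  \<comment> \<open>The additional set contains no element of \<open>S\<close>, so dropping index
    \<open>m\<close> keeps \<open>S\<close> covered.\<close>
  define C where "C = (!) Ys ` (J \<inter> {..<m})"
  have "C \<subseteq> X" using Ys by (auto simp: C_def)
  moreover have "card C \<le> k"
    using card_image_le[of "J \<inter> {..<m}" "(!) Ys"] card_mono[of J "J \<inter> {..<m}"] fin J(2)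
    by (simp add: C_def)
  moreover have "\<Union>C = S"
  proof
    show "\<Union>C \<subseteq> S" using \<open>C \<subseteq> X\<close> inst unfolding set_cover_instance_def by blast
    show "S \<subseteq> \<Union>C"
    proof
      fix x assume "x \<in> S"
      then obtain i where i: "i < n" "x = xs ! i" using xs by (metis in_set_conv_nth)
      then obtain j where "j \<in> J" "member j i" using J(3)[of i] by auto
      then show "x \<in> \<Union>C" using i I[of j i] by (auto simp: member_def C_def)
    qed
  qed
  ultimately show "set_cover S X k" unfolding set_cover_def by blast
qed

end

section \<open>The reduction as a generator\<close>

text \<open>Truth values are numbers with \<open>0\<close> as false and every positive number as
  true; \<open>Plus\<close> is disjunction and \<open>Times\<close> conjunction. A double
  \<open>Neg\<close> normalises to \<open>0\<close> or \<open>1\<close>.\<close>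

definition Neg :: "exp \<Rightarrow> exp" where
  "Neg e = Minus (Const 1) e"

definition Eq :: "exp \<Rightarrow> exp \<Rightarrow> exp" where
  "Eq a b = Neg (Plus (Minus a b) (Minus b a))"

definition Less :: "exp \<Rightarrow> exp \<Rightarrow> exp" where
  "Less a b = Minus b a"

lemma val_Neg [simp]: "val I (Neg e) c = of_bool (val I e c = 0)"
  by (simp add: Neg_def)

lemma val_Eq [simp]: "val I (Eq a b) c = of_bool (val I a c = val I b c)"
  by (auto simp: Eq_def)

lemma val_Less_pos [simp]: "0 < val I (Less a b) c \<longleftrightarrow> val I a c < val I b c"
  by (auto simp: Less_def)

lemma val_Less_zero [simp]: "val I (Less a b) c = 0 \<longleftrightarrow> \<not> val I a c < val I b c"
  by (auto simp: Less_def)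

lemma vars_Neg [simp]: "vars (Neg e) = vars e"
  by (simp add: Neg_def)

lemma vars_Eq [simp]: "vars (Eq a b) = vars a \<union> vars b"
  by (auto simp: Eq_def)

lemma vars_Less [simp]: "vars (Less a b) = vars a \<union> vars b"
  by (auto simp: Less_def)

abbreviation nE :: exp where "nE \<equiv> Var 0"
abbreviation mE :: exp where "mE \<equiv> Var 1"
abbreviation kE :: exp where "kE \<equiv> Var 2"
abbreviation qE :: exp where "qE \<equiv> Plus (Times (Const 2) kE) (Const 1)"

definition member_exp :: "exp \<Rightarrow> exp \<Rightarrow> exp" where
  "member_exp j i = Plus (Times (Neg (Less mE j)) (Eq i nE))
     (Times (Times (Less j mE) (Less i nE)) (Input (Plus (Times j nE) i)))"

definition adj_FF :: "exp \<Rightarrow> exp \<Rightarrow> exp" where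
  "adj_FF j j' = Times (Neg (Eq j j'))
     (Plus (Plus (Eq j (Plus mE (Const 1))) (Eq j' (Plus mE (Const 1))))
       (Times (Neg (Eq j (Plus mE (Const 2)))) (Neg (Eq j' (Plus mE (Const 2))))))"

definition adj_FP :: "exp \<Rightarrow> exp \<Rightarrow> exp \<Rightarrow> exp" where
  "adj_FP j i b = Times (Neg (Eq j (Plus mE (Const 2)))) (Plus (Eq b qE) (member_exp j i))"

definition adj_PP :: "exp \<Rightarrow> exp \<Rightarrow> exp \<Rightarrow> exp \<Rightarrow> exp \<Rightarrow> exp \<Rightarrow> exp" where
  "adj_PP i a b i' a' b' =
     Times (Neg (Times (Times (Eq i i') (Eq a a')) (Eq b b'))) (Plus (Eq a a') (Eq b b'))"

text \<open>The factor \<open>z\<close> of the bounds serves to switch the loops off.\<close>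

definition for_vertices :: "exp \<Rightarrow> gen \<Rightarrow> gen \<Rightarrow> gen" where
  "for_vertices z gF gP = Cat (For (Times z (Plus mE (Const 3))) gF)
     (For (Times z (Plus nE (Const 1))) (For qE (For (Plus qE (Const 1)) gP)))"

text \<open>The trivial instance with \<open>S = {}\<close> and \<open>k = 0\<close> is mapped to the empty graph.\<close>

abbreviation nontrivial :: exp where
  "nontrivial \<equiv> Neg (Neg (Plus nE kE))"

text \<open>A loop takes two variables, so an outer \<open>Family\<close> loop has index
  \<open>3\<close> and its inner loops start at \<open>5\<close>; outer points have indices
  \<open>3\<close>, \<open>5\<close>, \<open>7\<close> and their inner loops start at
  \<open>9\<close>.\<close>

definition matrix_gen :: gen where
  "matrix_gen = for_vertices nontrivial
     (for_vertices (Const 1) (Digit (adj_FF (Var 3) (Var 5))) (Digit (adj_FP (Var 3) (Var 5) (Var 9))))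
     (for_vertices (Const 1) (Digit (adj_FP (Var 9) (Var 3) (Var 7)))
       (Digit (adj_PP (Var 3) (Var 5) (Var 7) (Var 9) (Var 11) (Var 13))))"

definition unary_gen :: "exp \<Rightarrow> gen" where
  "unary_gen e = Cat (For e (Digit (Const 1))) (Digit (Const 0))"

text \<open>The first number is \<open>length vertices\<close>, or \<open>0\<close> for the trivial
  instance.\<close>

definition instance_gen :: gen where
  "instance_gen =
     Cat (unary_gen (Times nontrivial
       (Plus (Plus mE (Const 3)) (Times (Plus nE (Const 1)) (Times qE (Plus qE (Const 1)))))))
     (Cat (unary_gen kE) (Cat (unary_gen (Const 2)) matrix_gen))"

lemma wf_instance_gen: "wf_gen instance_gen 3"
  by (simp add: instance_gen_def unary_gen_def matrix_gen_def for_vertices_def adj_FF_def adj_FP_def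
      adj_PP_def member_exp_def)

section \<open>Correctness of the generated word\<close>

lemma emits_For:
  assumes "val I e c = N"
    and "\<And>i. i < N \<Longrightarrow> emits I g (r + 2) (c(r := i, r + 1 := N - Suc i)) = f i"
  shows "emits I (For e g) r c = concat (map f [0..<N])"
  unfolding emits.simps assms(1)
  by (rule arg_cong[where f = concat], rule map_cong) (use assms(2) in auto)

lemma emits_unary_gen: "emits I (unary_gen e) r c = unary (val I e c)"
proof -
  have "emits I (For e (Digit (Const 1))) r c = concat (map (\<lambda>_. [True]) [0..<val I e c])"
    by (rule emits_For) simp_all
  also have "\<dots> = replicate (val I e c) True"
    by (simp add: map_replicate_const)
  finally show ?thesis by (simp add: unary_gen_def unary_def)
qed

lemma concat_map_concat: "concat (map f (concat xss)) = concat (map (\<lambda>xs. concat (map f xs)) xss)"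
  by (induction xss) auto

context gadget
begin

text \<open>The assumptions on the bodies fix only the outer variables and the loop indices, which
  leaves the remaining counts open. One loop raises the level by \<open>2\<close>, the three loops
  for points by \<open>6\<close>.\<close>

lemma emits_for_vertices:
  assumes c: "c 0 = n" "c 1 = m" "c 2 = k" and r: "3 \<le> r" and z: "val I z c = 1"
    and F: "\<And>c' j. (\<And>x. x < r \<Longrightarrow> c' x = c x) \<Longrightarrow> c' r = j \<Longrightarrow>
      emits I gF (r + 2) c' = f (Family j)"
    and P: "\<And>c' i a b. (\<And>x. x < r \<Longrightarrow> c' x = c x) \<Longrightarrow> c' r = i \<Longrightarrow> c' (r + 2) = a \<Longrightarrow>
      c' (r + 4) = b \<Longrightarrow> emits I gP (r + 6) c' = f (Point i a b)"
  shows "emits I (for_vertices z gF gP) r c = concat (map f vertices)"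
proof -
  have family: "emits I (For (Times z (Plus mE (Const 3))) gF) r c =
      concat (map (\<lambda>j. f (Family j)) [0..<m + 3])"
    by (rule emits_For) (use c z F in auto)
  have points: "emits I (For (Times z (Plus nE (Const 1))) (For qE (For (Plus qE (Const 1)) gP))) r c =
      concat (map (\<lambda>i. concat (map (\<lambda>a. concat (map (\<lambda>b. f (Point i a b)) [0..<q + 1])) [0..<q]))
        [0..<n + 1])"
  proof (intro emits_For)
    fix i a b
    let ?c = "c(r := i, r + 1 := n + 1 - Suc i, r + 2 := a, r + 2 + 1 := q - Suc a,
      r + 2 + 2 := b, r + 2 + 2 + 1 := q + 1 - Suc b)"
    have "emits I gP (r + 6) ?c = f (Point i a b)"
      by (rule P) auto
    then show "emits I gP (r + 2 + 2 + 2) ?c = f (Point i a b)"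
      by (simp add: numeral_eq_Suc)
  qed (use c r z in auto)
  show ?thesis
    unfolding for_vertices_def emits.simps(2) family points
    by (simp add: vertices_def concat_map_concat comp_def del: upt_Suc)
qed

lemma val_member_exp:
  assumes "c 0 = n" "c 1 = m"
  shows "0 < val I (member_exp j i) c \<longleftrightarrow> member (val I j c) (val I i c)"
  using assms by (simp add: member_exp_def member_def not_less)

lemma emits_adj_FF:
  assumes "c 1 = m" "val I x c = j" "val I y c = j'"
  shows "emits I (Digit (adj_FF x y)) r c = [adj (Family j) (Family j')]"
  using assms by (simp add: adj_FF_def)

text \<open>The row \<open>a\<close> is arbitrary, as adjacency to a \<open>Family\<close> vertex
  depends only on element and column.\<close>

lemma emits_adj_FP:
  assumes "c 0 = n" "c 1 = m" "c 2 = k" "val I x c = j" "val I y c = i" "val I z c = b"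
  shows "emits I (Digit (adj_FP x y z)) r c = [adj (Family j) (Point i a b)]"
  using assms val_member_exp[of c x y] by (simp add: adj_FP_def)

lemma emits_adj_PP:
  "emits I (Digit (adj_PP x y z x' y' z')) r c =
    [adj (Point (val I x c) (val I y c) (val I z c)) (Point (val I x' c) (val I y' c) (val I z' c))]"
  by (simp add: adj_PP_def)

lemma emits_matrix_gen:
  assumes "n \<noteq> 0 \<or> k \<noteq> 0"
  shows "emits I matrix_gen 3 (params n m k) = concat (map (\<lambda>u. map (adj u) vertices) vertices)"
proof -
  \<comment> \<open>Entries become words of length one, so that each row has the form required for
    the inner loops.\<close>
  have row: "map (adj u) vertices = concat (map (\<lambda>v. [adj u v]) vertices)" for u
    by (induction vertices) auto
  show ?thesis
    unfolding matrix_gen_def row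
  proof (rule emits_for_vertices)
    fix c j
    assume c: "\<And>x. x < 3 \<Longrightarrow> c x = params n m k x" "c 3 = j"
    then have p: "c 0 = n" "c 1 = m" "c 2 = k" by (simp_all add: params_def)
    show "emits I (for_vertices (Const 1) (Digit (adj_FF (Var 3) (Var 5)))
        (Digit (adj_FP (Var 3) (Var 5) (Var 9)))) (3 + 2) c =
      concat (map (\<lambda>v. [adj (Family j) v]) vertices)"
    proof (rule emits_for_vertices)
      fix c' j'
      assume "\<And>x. x < 3 + 2 \<Longrightarrow> c' x = c x" "c' (3 + 2) = j'"
      then show "emits I (Digit (adj_FF (Var 3) (Var 5))) (3 + 2 + 2) c' =
          [adj (Family j) (Family j')]"
        using c p by (intro emits_adj_FF) auto
    next
      fix c' i a b
      assume "\<And>x. x < 3 + 2 \<Longrightarrow> c' x = c x" "c' (3 + 2) = i" "c' (3 + 2 + 2) = a"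
        "c' (3 + 2 + 4) = b"
      then show "emits I (Digit (adj_FP (Var 3) (Var 5) (Var 9))) (3 + 2 + 6) c' =
          [adj (Family j) (Point i a b)]"
        using c p by (intro emits_adj_FP) auto
    qed (use p in simp_all)
  next
    fix c i a b
    assume c: "\<And>x. x < 3 \<Longrightarrow> c x = params n m k x" "c 3 = i" "c (3 + 2) = a" "c (3 + 4) = b"
    then have p: "c 0 = n" "c 1 = m" "c 2 = k" by (simp_all add: params_def)
    show "emits I (for_vertices (Const 1) (Digit (adj_FP (Var 9) (Var 3) (Var 7)))
        (Digit (adj_PP (Var 3) (Var 5) (Var 7) (Var 9) (Var 11) (Var 13)))) (3 + 6) c =
      concat (map (\<lambda>v. [adj (Point i a b) v]) vertices)"
    proof (rule emits_for_vertices)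
      fix c' j
      assume "\<And>x. x < 3 + 6 \<Longrightarrow> c' x = c x" "c' (3 + 6) = j"
      then show "emits I (Digit (adj_FP (Var 9) (Var 3) (Var 7))) (3 + 6 + 2) c' =
          [adj (Point i a b) (Family j)]"
        unfolding adj_commute[of "Point i a b"] using c p by (intro emits_adj_FP) auto
    next
      fix c' i' a' b'
      assume "\<And>x. x < 3 + 6 \<Longrightarrow> c' x = c x" "c' (3 + 6) = i'" "c' (3 + 6 + 2) = a'"
        "c' (3 + 6 + 4) = b'"
      then show "emits I (Digit (adj_PP (Var 3) (Var 5) (Var 7) (Var 9) (Var 11) (Var 13)))
          (3 + 6 + 6) c' = [adj (Point i a b) (Point i' a' b')]"
        unfolding emits_adj_PP using c by simp
    qed (use p in simp_all)
  qed (use assms in \<open>auto simp: params_def\<close>)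
qed

lemma emits_instance_gen:
  assumes "n \<noteq> 0 \<or> k \<noteq> 0"
  shows "u_bcmd_code (emits I instance_gen 3 (params n m k)) V E k 2"
proof -
  let ?vs = "map to_nat vertices :: nat list"
  have "map (\<lambda>u. map (adj u) vertices) vertices = map (\<lambda>u. map (\<lambda>v. {u, v} \<in> E) ?vs) ?vs"
    by (simp add: edge_iff)
  then have matrix: "emits I matrix_gen 3 (params n m k) =
      concat (map (\<lambda>u. map (\<lambda>v. {u, v} \<in> E) ?vs) ?vs)"
    by (simp only: emits_matrix_gen[OF assms])
  have all: "emits I instance_gen 3 (params n m k) =
      unary (length ?vs) @ unary k @ unary 2 @ emits I matrix_gen 3 (params n m k)"
    using assms by (simp add: instance_gen_def emits_unary_gen params_def length_vertices)
  have "distinct ?vs" "set ?vs = V"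
    using distinct_vertices by (simp_all add: distinct_map)
  then show ?thesis
    unfolding u_bcmd_code_def all matrix by (intro conjI exI[of _ ?vs] ugraph_gadget refl)
qed

lemma emits_instance_gen_trivial:
  assumes "n = 0" "k = 0"
  shows "u_bcmd_code (emits I instance_gen 3 (params n m k)) {} {} k 2"
  using assms by (simp add: u_bcmd_code_def ugraph_def instance_gen_def matrix_gen_def
      for_vertices_def emits_unary_gen params_def)

end

text \<open>The supremum over no vertices is \<open>0\<close>.\<close>

lemma u_bcmd_empty: "u_bcmd {} {} k d"
proof -
  have "graph_diameter {} ({} \<union> {}) \<le> enat d"
    by (simp add: graph_diameter_le_iff)
  then show ?thesis unfolding u_bcmd_def by force
qed

lemma nth_incidence_matrix:
  assumes "j < length Ys" "i < length xs"
  shows "j * length xs + i < length (concat (map (\<lambda>Y. map (\<lambda>x. x \<in> Y) xs) Ys)) \<and>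
    concat (map (\<lambda>Y. map (\<lambda>x. x \<in> Y) xs) Ys) ! (j * length xs + i) = (xs ! i \<in> Ys ! j)"
  using assms
proof (induction Ys arbitrary: j)
  case (Cons Y Ys)
  then show ?case by (cases j) (auto simp: nth_append)
qed simp

theorem theorem6:
  shows "\<exists>f :: bool list \<Rightarrow> bool list.
    poly_time_computable_on {w. \<exists>(S :: nat set) X k. set_cover_code w S X k} f \<and>
    (\<forall>w (S :: nat set) X k. set_cover_code w S X k \<longrightarrow>
       (\<exists>(V :: nat set) E.
          u_bcmd_code (f w) V E k 2 \<and>
          (set_cover S X k \<longleftrightarrow> u_bcmd V E k 2) \<and>
          (S \<noteq> {} \<or> k \<noteq> 0 \<longrightarrow> graph_diameter V E = 3)))"
proof (intro exI[of _ "run_gen instance_gen"] conjI allI impI)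
  show "poly_time_computable_on {w. \<exists>(S :: nat set) X k. set_cover_code w S X k}
      (run_gen instance_gen)"
    by (rule poly_time_run_gen[OF wf_instance_gen]) (auto simp: set_cover_code_def)
next
  fix w and S :: "nat set" and X k
  assume "set_cover_code w S X k"
  then obtain xs Ys where inst: "set_cover_instance S X"
    and xs: "distinct xs" "set xs = S" and Ys: "distinct Ys" "set Ys = X"
    and w: "w = unary (length xs) @ unary (length Ys) @ unary k @
      concat (map (\<lambda>Y. map (\<lambda>x. x \<in> Y) xs) Ys)"
    unfolding set_cover_code_def by blast
  define bs where "bs = concat (map (\<lambda>Y. map (\<lambda>x. x \<in> Y) xs) Ys)"
  \<comment> \<open>\<open>False\<close> behind the matrix matches the blanks that the machine reads
    there.\<close>
  define I where "I i \<longleftrightarrow> i < length bs \<and> bs ! i" for i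
  interpret gadget "length xs" "length Ys" k I .
  have f: "run_gen instance_gen w =
      emits I instance_gen 3 (params (length xs) (length Ys) k)"
    unfolding w bs_def[symmetric] run_gen_unary I_def[abs_def] ..
  show "\<exists>(V :: nat set) E. u_bcmd_code (run_gen instance_gen w) V E k 2 \<and>
      (set_cover S X k \<longleftrightarrow> u_bcmd V E k 2) \<and> (S \<noteq> {} \<or> k \<noteq> 0 \<longrightarrow> graph_diameter V E = 3)"
  proof (cases "S = {} \<and> k = 0")
    \<comment> \<open>The empty family is a cover and the image is the empty graph, so both are
      yes-instances.\<close>
    case True
    then have "u_bcmd_code (run_gen instance_gen w) {} {} k 2"
      unfolding f using xs by (intro emits_instance_gen_trivial) auto
    moreover have "set_cover S X k" using True by (auto simp: set_cover_def)
    ultimately show ?thesis using True u_bcmd_empty by blast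
  next
    case False
    then have "u_bcmd_code (run_gen instance_gen w) V E k 2"
      unfolding f using xs by (intro emits_instance_gen) auto
    moreover have "set_cover S X k \<longleftrightarrow> u_bcmd V E k 2"
      using inst xs Ys False
      by (intro set_cover_iff_u_bcmd) (auto simp: I_def bs_def nth_incidence_matrix)
    ultimately show ?thesis using diameter_gadget by blast
  qed
qed

end
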